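(* Let $t,\theta>0$ and $\lambda>1$. Then $$\rho_{t,\theta,\lambda}=D_{t(\lambda-1)}\Big(\gamma\big(\tfrac{t}{\theta(\lambda-1)},1\big)\circledast\gamma\big(1+\tfrac t\theta,1\big)^{\langle-1\rangle}\Big)=\rho_{t,\theta,1}\circledast\gamma\Big(\frac{t}{\theta(\lambda-1)},\frac{\theta(\lambda-1)}{t}\Big),$$ and $\rho_{t,\theta,\lambda}$ is (classically) selfdecomposable. In particular $\rho_{t,\theta,1+t/\theta}=\rho_{t,\theta,1}\circledast\gamma(1,1)$, so it is a mixture of exponential distributions (the law of $EZ$ with $E$ exponential and $Z\ge0$ independent).
   Context: For $t,\theta>0,\lambda\ge1$ define on $(0,\infty)$ the potential $V_{t,\theta,1}(x)=(2+\frac t\theta)\log x+\frac{t^2}{\theta x}$ and, for $\lambda>1$, $V_{t,\theta,\lambda}(x)=\big(1-\frac{t}{\theta(\lambda-1)}\big)\log x+\big(1+\frac{t\lambda}{\theta(\lambda-1)}\big)\log(x+t(\lambda-1))$. The Gibbs measure is $\rho_{t,\theta,\lambda}(dx)=\mathcal Z_{t,\theta,\lambda}^{-1}e^{-V_{t,\theta,\lambda}(x)}\mathbf 1_{(0,\infty)}(x)dx$ with $\mathcal Z_{t,\theta,\lambda}=\int_0^\infty e^{-V_{t,\theta,\lambda}(x)}dx$. The gamma distribution is $\gamma(a,b)(dx)=\frac{1}{b^a\Gamma(a)}x^{a-1}e^{-x/b}\mathbf 1_{(0,\infty)}(x)dx$. For $\mu$ on $(0,\infty)$, $\mu^{\langle-1\rangle}(B)=\mu(\{x^{-1}:x\in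 B\})$; $D_c(\mu)(B)=\mu(\{x/c:x\in B\})$. $\circledast$ denotes classical multiplicative convolution (law of the product of independent random variables). *)

theory Defs
  imports "HOL-Probability.Probability"
begin

definition V_pot :: "real \<Rightarrow> real \<Rightarrow> real \<Rightarrow> real \<Rightarrow> real" where
  "V_pot t \<theta> l x =
     (if l = 1 then (2 + t / \<theta>) * ln x + t\<^sup>2 / (\<theta> * x)
      else (1 - t / (\<theta> * (l - 1))) * ln x
           + (1 + t * l / (\<theta> * (l - 1))) * ln (x + t * (l - 1)))"

definition Z_norm :: "real \<Rightarrow> real \<Rightarrow> real \<Rightarrow> real" where
  "Z_norm t \<theta> l = (\<integral>x\<in>{0<..}. exp (- V_pot t \<theta> l x) \<partial>lborel)"

definition rho :: "real \<Rightarrow> real \<Rightarrow> real \<Rightarrow> real measure" where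
  "rho t \<theta> l = density lborel
     (\<lambda>x. ennreal (indicator {0<..} x * exp (- V_pot t \<theta> l x) / Z_norm t \<theta> l))"

definition gamma_dist :: "real \<Rightarrow> real \<Rightarrow> real measure" where
  "gamma_dist a b = density lborel
     (\<lambda>x. ennreal (indicator {0<..} x * x powr (a - 1) * exp (- x / b) / (b powr a * Gamma a)))"

definition meas_inv :: "real measure \<Rightarrow> real measure" where
  "meas_inv \<mu> = distr \<mu> borel (\<lambda>x. inverse x)"

definition dilate :: "real \<Rightarrow> real measure \<Rightarrow> real measure" where
  "dilate c \<mu> = distr \<mu> borel (\<lambda>x. c * x)"

definition mult_conv :: "real measure \<Rightarrow> real measure \<Rightarrow> real measure" where
  "mult_conv \<mu> \<nu> = distr (\<mu> \<Otimes>\<^sub>M \<nu>) borel (\<lambda>(x, y). x * y)"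

definition selfdecomposable :: "real measure \<Rightarrow> bool" where
  "selfdecomposable \<mu> \<longleftrightarrow>
     (\<forall>c. 0 < c \<and> c < 1 \<longrightarrow>
        (\<exists>\<nu>. prob_space \<nu> \<and> sets \<nu> = sets borel \<and> \<mu> = convolution (dilate c \<mu>) \<nu>))"

end

theory Submission
  imports Defs
begin

text \<open>
  Up to dilation, \<open>rho t \<theta> l\<close> is the law of a quotient of independent gamma variables, i.e. a beta
  prime law with parameters \<open>a = t / (\<theta> (l - 1))\<close> and \<open>b = 1 + t / \<theta>\<close>.  Its Laplace transform
  \<open>\<phi>\<close> solves Kummer's equation \<open>u \<phi>'' + (1 - b - u) \<phi>' - a \<phi> = 0\<close>, so \<open>\<psi> = - \<phi>' / \<phi>\<close> solves a
  Riccati equation.  Writing \<open>\<psi> u = (a - M u) / u\<close>, this becomes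
  \<open>u M' = u M - (M - a) (M - a - b)\<close>, which is the Laplace transformed version of
  \<open>(1 + x) m' = - (1 + 2 a + b) m + m * m\<close>, \<open>m 0 = a (a + b)\<close>.  The solution \<open>m\<close> of the latter is
  visibly nonnegative, hence \<open>M\<close> is the Laplace transform of a positive measure, and this is exactly
  the monotonicity of the Levy density times \<open>x\<close> that selfdecomposability requires:
  \<open>\<phi> u / \<phi> (c u)\<close> is the Laplace transform of a compound Poisson law.
\<close>

text \<open>If a law has Levy density \<open>k x / x\<close> with \<open>k\<close> decreasing to 0,
  then \<open>\<psi>\<close> is the Laplace transform of \<open>k\<close>, and integration by parts
  gives \<open>u * \<psi> u = k 0 - M u\<close> with \<open>M\<close> the transform of
  \<open>- k'\<close>. This is the origin of the shift by \<open>a\<close>: it is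
  \<open>k 0\<close>, hence the total mass of the measure behind \<open>M\<close>. None of this is
  presupposed. The convolution equation is solved by monotone iteration, so positivity holds by
  construction, and neither Bernstein's theorem nor the Levy-Khintchine formula enters. The price is
  that the solution has a priori nothing to do with the beta prime law. The two are not compared at
  \<open>u = 0\<close>, where both differential equations are singular, but at infinity: the defect
  between them solves a linear equation whose nonzero solutions blow up, while the defect itself
  stays bounded.\<close>

section \<open>Laplace transforms of finite measures on the half line\<close>

definition nonneg_measure :: "real measure \<Rightarrow> bool" where
  "nonneg_measure M \<longleftrightarrow> finite_measure M \<and> sets M = sets borel \<and> (AE x in M. 0 \<le> x)"

text \<open>For \<open>u > 0\<close> this is the \<open>k\<close>-th derivative of the Laplace
  transform without its sign \<open>(- 1) ^ k\<close>, so that all these functions are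
  nonnegative.\<close>

definition laplace_moment :: "nat \<Rightarrow> real measure \<Rightarrow> real \<Rightarrow> real" where
  "laplace_moment k M u = (\<integral>x. x ^ k * exp (- (u * x)) \<partial>M)"

abbreviation laplace :: "real measure \<Rightarrow> real \<Rightarrow> real" where
  "laplace \<equiv> laplace_moment 0"

lemma nonneg_measureD:
  assumes "nonneg_measure M"
  shows "finite_measure M" "sets M = sets borel" "AE x in M. 0 \<le> x"
  using assms by (auto simp: nonneg_measure_def)

text \<open>A single term of the exponential series of \<open>v * x\<close> is at most the sum. The
  bound makes every exponentially weighted moment finite, although plain moments may be infinite, as
  they are for heavy-tailed beta prime laws.\<close>

lemma power_exp_bound:
  fixes x v :: real
  assumes "x \<ge> 0" "v > 0"
  shows "x ^ k * exp (- (v * x)) \<le> fact k / v ^ k"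
proof -
  have s: "(\<lambda>n. (v * x) ^ n /\<^sub>R fact n) sums exp (v * x)"
    by (rule exp_converges)
  have "(v * x) ^ k /\<^sub>R fact k = (\<Sum>n\<in>{k}. (v * x) ^ n /\<^sub>R fact n)" by simp
  also have "\<dots> \<le> exp (v * x)"
    unfolding sums_unique[OF s]
    by (rule sum_le_suminf) (use s assms in \<open>auto simp: sums_iff\<close>)
  finally have "(v * x) ^ k \<le> fact k * exp (v * x)"
    by (simp add: divide_simps mult.commute)
  then show ?thesis using assms
    by (simp add: exp_minus field_simps power_mult_distrib)
qed

lemma integrable_laplace_moment:
  assumes M: "nonneg_measure M" and "u > 0"
  shows "integrable M (\<lambda>x. x ^ k * exp (- (u * x)))"
proof -
  interpret finite_measure M using M by (rule nonneg_measureD)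
  note [measurable_cong] = nonneg_measureD(2)[OF M]
  have "AE x in M. norm (x ^ k * exp (- (u * x))) \<le> fact k / u ^ k"
    using nonneg_measureD(3)[OF M]
    by eventually_elim (use power_exp_bound[of _ u k] \<open>u > 0\<close> in auto)
  then show ?thesis by (intro integrable_const_bound) measurable
qed

text \<open>Unlike \<open>integrable_laplace_moment\<close> this admits \<open>u = 0\<close>, where
  finiteness of the measure controls only the zeroth moment.\<close>

lemma integrable_laplace:
  assumes M: "nonneg_measure M" and "u \<ge> 0"
  shows "integrable M (\<lambda>x. exp (- (u * x)))"
proof -
  interpret finite_measure M using M by (rule nonneg_measureD)
  note [measurable_cong] = nonneg_measureD(2)[OF M]
  have "AE x in M. norm (exp (- (u * x))) \<le> 1"
    using nonneg_measureD(3)[OF M] by eventually_elim (use \<open>u \<ge> 0\<close> in auto)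
  moreover have "(\<lambda>x. exp (- (u * x))) \<in> borel_measurable M" by measurable
  ultimately show ?thesis by (rule integrable_const_bound)
qed

lemma nn_integral_laplace:
  assumes M: "nonneg_measure M" and "u \<ge> 0"
  shows "(\<integral>\<^sup>+x. ennreal (exp (- (u * x))) \<partial>M) = ennreal (laplace M u)"
  using nn_integral_eq_integral[OF integrable_laplace[OF assms]]
  by (simp add: laplace_moment_def)

lemma laplace_moment_nonneg:
  assumes "nonneg_measure M"
  shows "0 \<le> laplace_moment k M u"
  unfolding laplace_moment_def using nonneg_measureD(3)[OF assms]
  by (intro integral_nonneg_AE) (auto elim!: eventually_mono)

lemma laplace_moment_le:
  assumes M: "nonneg_measure M" and "v > 0" "v \<le> u"
  shows "laplace_moment k M u \<le> laplace_moment k M v"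
  unfolding laplace_moment_def
proof (rule integral_mono_AE)
  show "AE x in M. x ^ k * exp (- (u * x)) \<le> x ^ k * exp (- (v * x))"
    using nonneg_measureD(3)[OF M]
    by eventually_elim (use assms in \<open>auto intro!: mult_left_mono mult_right_mono\<close>)
qed (use assms integrable_laplace_moment[OF M] in auto)

lemma laplace_le_mass:
  assumes M: "nonneg_measure M" and "u \<ge> 0"
  shows "laplace M u \<le> measure M UNIV"
proof -
  interpret finite_measure M using M by (rule nonneg_measureD)
  have sp: "space M = UNIV"
    using nonneg_measureD(2)[OF M] by (metis sets_eq_imp_space_eq space_borel)
  have "laplace M u \<le> (\<integral>x. 1 \<partial>M)"
    unfolding laplace_moment_def
    using nonneg_measureD(3)[OF M] integrable_laplace[OF assms] \<open>u \<ge> 0\<close>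
    by (intro integral_mono_AE) (auto elim!: eventually_mono)
  then show ?thesis by (simp add: sp)
qed

text \<open>A mean value estimate with a common lower bound for both exponents; it dominates the
  difference quotients of the Laplace transform.\<close>

lemma exp_minus_diff_le:
  fixes p q v :: real
  assumes "v \<le> p" "v \<le> q"
  shows "\<bar>exp (- p) - exp (- q)\<bar> \<le> \<bar>p - q\<bar> * exp (- v)"
proof -
  have *: "exp (- p) - exp (- q) \<le> (q - p) * exp (- v)" if "v \<le> p" "p \<le> q" for p q :: real
  proof -
    have "exp (- p) - exp (- q) = exp (- p) * (1 - exp (- (q - p)))"
      by (simp add: algebra_simps flip: exp_add)
    also have "\<dots> \<le> exp (- v) * (q - p)"
    proof (rule mult_mono)
      show "1 - exp (- (q - p)) \<le> q - p" using exp_ge_add_one_self[of "- (q - p)"] by linarith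
    qed (use that in auto)
    finally show ?thesis by (simp add: mult.commute)
  qed
  show ?thesis
    using *[of p q] *[of q p] assms by (cases "p \<le> q") (auto simp: abs_if)
qed

text \<open>Differentiation under the integral, along sequences so that dominated convergence
  applies. The dominating function keeps only the rate \<open>u / 2\<close>, which still makes the
  additional factor \<open>x\<close> integrable.\<close>

lemma has_derivative_laplace_moment:
  assumes M: "nonneg_measure M" and u: "u > 0"
  shows "(laplace_moment k M has_real_derivative - laplace_moment (Suc k) M u) (at u)"
  unfolding has_field_derivative_iff tendsto_at_iff_sequentially
proof (intro allI impI)
  interpret finite_measure M using M by (rule nonneg_measureD)
  note [measurable_cong] = nonneg_measureD(2)[OF M]
  fix X :: "nat \<Rightarrow> real"
  assume X: "\<forall>i. X i \<in> UNIV - {u}" "X \<longlonglongrightarrow> u"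
  \<comment> \<open>Dropping the first \<open>N\<close> terms keeps the sequence above
    \<open>u / 2\<close>, where the dominating function is valid; \<open>LIMSEQ_offset\<close>
    restores them at the end.\<close>
  from order_tendstoD(1)[OF X(2), of "u/2"] u obtain N where N: "\<And>n. n \<ge> N \<Longrightarrow> X n > u / 2"
    by (auto simp: eventually_sequentially)
  define s where "s n x = (x ^ k * exp (- (X (n + N) * x)) - x ^ k * exp (- (u * x))) / (X (n + N) - u)" for n x
  have "(\<lambda>n. integral\<^sup>L M (s n)) \<longlonglongrightarrow> integral\<^sup>L M (\<lambda>x. - (x ^ Suc k * exp (- (u * x))))"
  proof (rule integral_dominated_convergence[where w = "\<lambda>x. x ^ Suc k * exp (- (u / 2 * x))"])
    show "AE x in M. norm (s n x) \<le> x ^ Suc k * exp (- (u / 2 * x))" for n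
      using nonneg_measureD(3)[OF M]
    proof eventually_elim
      case (elim x)
      have "\<bar>exp (- (X (n + N) * x)) - exp (- (u * x))\<bar> \<le> \<bar>X (n + N) * x - u * x\<bar> * exp (- (u / 2 * x))"
        using N[of "n + N"] elim u by (intro exp_minus_diff_le mult_right_mono) auto
      also have "\<bar>X (n + N) * x - u * x\<bar> = \<bar>X (n + N) - u\<bar> * x"
        using elim by (simp add: abs_mult flip: left_diff_distrib)
      finally have *: "\<bar>exp (- (X (n + N) * x)) - exp (- (u * x))\<bar> \<le> \<bar>X (n + N) - u\<bar> * x * exp (- (u / 2 * x))" .
      have "norm (s n x) = x ^ k * (\<bar>exp (- (X (n + N) * x)) - exp (- (u * x))\<bar> / \<bar>X (n + N) - u\<bar>)"
        using elim by (simp add: s_def abs_mult flip: right_diff_distrib)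
      also have "\<dots> \<le> x ^ k * (x * exp (- (u / 2 * x)))"
        using * X(1)[rule_format, of "n + N"] elim
        by (intro mult_left_mono) (auto simp: divide_simps mult_ac)
      finally show ?case by (simp add: mult_ac)
    qed
    show "AE x in M. (\<lambda>n. s n x) \<longlonglongrightarrow> - (x ^ Suc k * exp (- (u * x)))"
    proof (rule AE_I2)
      fix x
      have "((\<lambda>v. x ^ k * exp (- (v * x))) has_real_derivative - (x ^ Suc k * exp (- (u * x)))) (at u)"
        by (auto intro!: derivative_eq_intros)
      then have "((\<lambda>i. (x ^ k * exp (- (i * x)) - x ^ k * exp (- (u * x))) / (i - u)) \<circ> X) \<longlonglongrightarrow> - (x ^ Suc k * exp (- (u * x)))"
        using X unfolding has_field_derivative_iff tendsto_at_iff_sequentially by blast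
      from LIMSEQ_ignore_initial_segment[OF this, of N]
      show "(\<lambda>n. s n x) \<longlonglongrightarrow> - (x ^ Suc k * exp (- (u * x)))" by (simp add: s_def)
    qed
    show "integrable M (\<lambda>x. x ^ Suc k * exp (- (u / 2 * x)))"
      by (rule integrable_laplace_moment[OF M]) (use u in simp)
    show "s n \<in> borel_measurable M" for n unfolding s_def by measurable
  qed measurable
  moreover have "integral\<^sup>L M (s n) = ((\<lambda>y. (laplace_moment k M y - laplace_moment k M u) / (y - u)) \<circ> X) (n + N)" for n
    using integrable_laplace_moment[OF M, of "X (n + N)" k] integrable_laplace_moment[OF M u, of k] N[of "n + N"] u
    unfolding s_def laplace_moment_def by simp
  ultimately have "(\<lambda>n. ((\<lambda>y. (laplace_moment k M y - laplace_moment k M u) / (y - u)) \<circ> X) (n + N))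
      \<longlonglongrightarrow> - laplace_moment (Suc k) M u"
    by (simp add: laplace_moment_def)
  then show "((\<lambda>y. (laplace_moment k M y - laplace_moment k M u) / (y - u)) \<circ> X) \<longlonglongrightarrow> - laplace_moment (Suc k) M u"
    by (rule LIMSEQ_offset)
qed

section \<open>Uniqueness of Laplace transforms\<close>

text \<open>The exponential series may be integrated termwise because moments on the unit interval
  are at most 1 in absolute value. Hence the moments determine such a law.\<close>

lemma char_eq_moments:
  assumes "prob_space N" and sets[measurable_cong]: "sets N = sets borel" and AE: "AE y in N. 0 \<le> y \<and> y \<le> 1"
  shows "char N \<xi> = (\<Sum>n. (\<i> * of_real \<xi>) ^ n /\<^sub>R fact n * of_real (\<integral>y. y ^ n \<partial>N))"
proof -
  interpret prob_space N by fact
  define f where "f n y = (\<i> * of_real \<xi>) ^ n /\<^sub>R fact n * of_real (y ^ n)" for n and y :: real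
  have nf: "norm (f n y) = \<bar>\<xi>\<bar> ^ n /\<^sub>R fact n * \<bar>y\<bar> ^ n" for n y
    by (simp add: f_def norm_mult norm_power norm_divide)
  have int: "integrable N (\<lambda>y. y ^ n)" for n
  proof (rule integrable_const_bound[where B = 1])
    show "AE x in N. norm (x ^ n) \<le> 1"
      using AE by eventually_elim (auto simp: power_le_one)
  qed measurable
  have sumf: "f n y = (\<i> * of_real \<xi> * of_real y) ^ n /\<^sub>R fact n" for n y
    by (simp add: f_def power_mult_distrib)
  have "(\<lambda>n. integral\<^sup>L N (f n)) sums (\<integral>y. (\<Sum>n. f n y) \<partial>N)"
  proof (rule sums_integral)
    show "integrable N (f n)" for n
      unfolding f_def by (intro integrable_mult_right integrable_of_real int)
    show "AE x in N. summable (\<lambda>n. norm (f n x))"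
      unfolding sumf by (intro AE_I2 summable_norm_exp)
    show "summable (\<lambda>i. \<integral>x. norm (f i x) \<partial>N)"
    proof (rule summable_comparison_test')
      show "summable (\<lambda>n. \<bar>\<xi>\<bar> ^ n /\<^sub>R fact n)" by (rule summable_exp_generic)
      show "norm (\<integral>x. norm (f n x) \<partial>N) \<le> \<bar>\<xi>\<bar> ^ n /\<^sub>R fact n" if "n \<ge> 0" for n
      proof -
        have "(\<integral>x. norm (f n x) \<partial>N) \<le> (\<integral>x. \<bar>\<xi>\<bar> ^ n /\<^sub>R fact n \<partial>N)"
        proof (rule integral_mono_AE)
          show "integrable N (\<lambda>x. norm (f n x))"
            unfolding f_def by (intro integrable_norm integrable_mult_right integrable_of_real int)
          show "AE x in N. norm (f n x) \<le> \<bar>\<xi>\<bar> ^ n /\<^sub>R fact n"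
            using AE by eventually_elim (auto simp: nf power_le_one intro!: mult_left_le)
        qed simp
        then show ?thesis by (simp add: prob_space)
      qed
    qed
  qed
  moreover have "(\<Sum>n. f n y) = iexp (\<xi> * y)" for y
    unfolding sumf using exp_converges[of "\<i> * of_real \<xi> * of_real y"] by (simp add: sums_iff mult.assoc)
  moreover have "integral\<^sup>L N (f n) = (\<i> * of_real \<xi>) ^ n /\<^sub>R fact n * of_real (\<integral>y. y ^ n \<partial>N)" for n
    unfolding f_def by (subst integral_mult_right_zero) (simp del: of_real_power)
  ultimately show ?thesis by (simp add: sums_iff char_def)
qed

text \<open>Under \<open>x \<mapsto> exp (- x)\<close> the Laplace transform at the natural numbers becomes the moment
  sequence of a law on the unit interval.\<close>
lemma laplace_unique:
  assumes M: "prob_space M" "nonneg_measure M" and N: "prob_space N" "nonneg_measure N"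
    and eq: "\<And>u. u > 0 \<Longrightarrow> laplace M u = laplace N u"
  shows "M = N"
proof -
  have pf: "prob_space (distr L borel (\<lambda>x. exp (- x))) \<and>
      (AE y in distr L borel (\<lambda>x. exp (- x)). 0 \<le> y \<and> y \<le> 1) \<and>
      (\<forall>n. (\<integral>y. y ^ n \<partial>distr L borel (\<lambda>x. exp (- x))) = laplace L (real n)) \<and>
      distr (distr L borel (\<lambda>x. exp (- x))) borel (\<lambda>y. - ln y) = L"
    if L: "prob_space L" "nonneg_measure L" for L :: "real measure"
  proof -
    interpret prob_space L by fact
    note [measurable_cong] = nonneg_measureD(2)[OF L(2)]
    have "(\<integral>y. y ^ n \<partial>distr L borel (\<lambda>x. exp (- x))) = laplace L (real n)" for n
      by (simp add: integral_distr laplace_moment_def flip: exp_of_nat_mult)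
    moreover have "AE y in distr L borel (\<lambda>x. exp (- x)). 0 \<le> y \<and> y \<le> 1"
      using nonneg_measureD(3)[OF L(2)] by (subst AE_distr_iff) auto
    moreover have "distr (distr L borel (\<lambda>x. exp (- x))) borel (\<lambda>y. - ln y) = L"
      by (simp add: distr_distr o_def distr_id2 nonneg_measureD(2)[OF L(2)])
    ultimately show ?thesis by (auto intro!: prob_space_distr)
  qed
  note pM = pf[OF M] and pN = pf[OF N]
  \<comment> \<open>The hypothesis \<open>eq\<close> is silent at 0; there both sides are the total
    mass 1.\<close>
  have lap: "laplace M (real n) = laplace N (real n)" for n
    using eq[of "real n"] prob_space.prob_space[OF M(1)] prob_space.prob_space[OF N(1)]
    by (cases "n = 0") (simp_all add: laplace_moment_def)
  have "char (distr M borel (\<lambda>x. exp (- x))) = char (distr N borel (\<lambda>x. exp (- x)))"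
    using pM pN lap by (intro ext) (simp add: char_eq_moments)
  then have "distr M borel (\<lambda>x. exp (- x)) = distr N borel (\<lambda>x. exp (- x))"
    using pM pN by (intro Levy_uniqueness) (auto simp: real_distribution_def real_distribution_axioms_def)
  then show ?thesis using pM pN by metis
qed

section \<open>Convolutions and compound Poisson laws\<close>

lemma nonneg_measure_convolution:
  assumes M: "nonneg_measure M" and N: "nonneg_measure N"
  shows "nonneg_measure (convolution M N)"
proof -
  interpret M: finite_measure M using M by (rule nonneg_measureD)
  interpret N: finite_measure N using N by (rule nonneg_measureD)
  interpret pair_sigma_finite M N ..
  note [measurable_cong] = nonneg_measureD(2)[OF M] nonneg_measureD(2)[OF N]
  have "(\<integral>\<^sup>+x. indicator {..<0} x \<partial>convolution M N) = (\<integral>\<^sup>+x. \<integral>\<^sup>+y. indicator {..<0} (x + y) \<partial>N \<partial>M)"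
    by (rule nn_integral_convolution) (use nonneg_measureD[OF M] nonneg_measureD[OF N] in auto)
  also have "\<dots> = (\<integral>\<^sup>+x. \<integral>\<^sup>+y. 0 \<partial>N \<partial>M)"
    using nonneg_measureD(3)[OF M]
  proof (intro nn_integral_cong_AE, eventually_elim)
    case (elim x)
    then show ?case using nonneg_measureD(3)[OF N]
      by (intro nn_integral_cong_AE) (auto elim!: eventually_mono split: split_indicator)
  qed
  finally have "emeasure (convolution M N) {..<0} = 0" by simp
  then have "AE x in convolution M N. 0 \<le> x"
    by (intro AE_I[of _ _ "{..<0}"]) (auto simp: not_le)
  moreover have "finite_measure (convolution M N)"
    using nonneg_measureD[OF M] nonneg_measureD[OF N] by (intro convolution_finite) auto
  ultimately show ?thesis by (simp add: nonneg_measure_def)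
qed

lemma laplace_convolution:
  assumes M: "nonneg_measure M" and N: "nonneg_measure N" and u: "u \<ge> 0"
  shows "laplace (convolution M N) u = laplace M u * laplace N u"
proof -
  note [measurable_cong] = nonneg_measureD(2)[OF M] nonneg_measureD(2)[OF N]
  have "ennreal (laplace (convolution M N) u) = (\<integral>\<^sup>+x. ennreal (exp (- (u * x))) \<partial>convolution M N)"
    by (simp add: nn_integral_laplace nonneg_measure_convolution M N u)
  also have "\<dots> = (\<integral>\<^sup>+x. \<integral>\<^sup>+y. ennreal (exp (- (u * (x + y)))) \<partial>N \<partial>M)"
    by (rule nn_integral_convolution) (use nonneg_measureD[OF M] nonneg_measureD[OF N] in auto)
  also have "\<dots> = (\<integral>\<^sup>+x. ennreal (exp (- (u * x))) * (\<integral>\<^sup>+y. ennreal (exp (- (u * y))) \<partial>N) \<partial>M)"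
    by (intro nn_integral_cong, subst nn_integral_cmult[symmetric])
       (auto simp: distrib_left simp flip: exp_add ennreal_mult)
  also have "\<dots> = ennreal (laplace M u * laplace N u)"
    by (simp add: nn_integral_multc nn_integral_laplace M N u ennreal_mult laplace_moment_nonneg)
  finally show ?thesis
    by (simp add: laplace_moment_nonneg M N nonneg_measure_convolution)
qed

lemma prob_space_convolution:
  assumes "prob_space M" "prob_space N" and [measurable_cong]: "sets M = sets borel" "sets N = sets borel"
  shows "prob_space (convolution M N)"
proof -
  interpret M: prob_space M by fact
  interpret N: prob_space N by fact
  interpret pair_prob_space M N ..
  show ?thesis unfolding convolution_def by (intro prob_space_distr) measurable
qed

text \<open>The law is the Poisson mixture of the convolution powers of \<open>Q\<close>; its
  transform is the Poisson generating function evaluated at \<open>laplace Q u\<close>.\<close>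

lemma compound_poisson:
  fixes \<Lambda> :: real
  assumes "\<Lambda> \<ge> 0" and Q: "prob_space Q" "nonneg_measure Q"
  obtains \<nu> where "prob_space \<nu>" "nonneg_measure \<nu>"
    "\<And>u. u \<ge> 0 \<Longrightarrow> laplace \<nu> u = exp (\<Lambda> * (laplace Q u - 1))"
proof -
  define P where "P = rec_nat (return borel (0 :: real)) (\<lambda>_. convolution Q)"
  have P0: "P 0 = return borel 0" and PS: "P (Suc n) = convolution Q (P n)" for n
    by (simp_all add: P_def)
  have P: "prob_space (P n)" "nonneg_measure (P n)" "u \<ge> 0 \<Longrightarrow> laplace (P n) u = laplace Q u ^ n" for n u
  proof (induction n)
    case 0
    show "prob_space (P 0)" by (simp add: P0 prob_space_return)
    then show "nonneg_measure (P 0)"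
      by (auto simp: P0 nonneg_measure_def AE_return prob_space_def)
    show "laplace (P 0) u = laplace Q u ^ 0"
      by (simp add: P0 laplace_moment_def integral_return)
  next
    case (Suc n)
    show "prob_space (P (Suc n))" "nonneg_measure (P (Suc n))"
      unfolding PS using Suc Q by (auto intro!: prob_space_convolution nonneg_measure_convolution dest: nonneg_measureD)
    show "laplace (P (Suc n)) u = laplace Q u ^ Suc n" if "u \<ge> 0"
      unfolding PS using Suc Q that by (simp add: laplace_convolution)
  qed
  have sets: "sets (P n) = sets borel" for n using P(2) by (rule nonneg_measureD)
  have P_meas [measurable]: "P \<in> measurable (measure_pmf p) (subprob_algebra borel)" for p
  proof -
    have "P n \<in> space (subprob_algebra borel)" for n
      using P(1)[of n] sets by (simp add: space_subprob_algebra prob_space_imp_subprob_space)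
    then show ?thesis by simp
  qed
  \<comment> \<open>The Poisson mixture is formed for a positive rate only; rate 0 is served by the
    point mass at 0.\<close>
  show thesis
  proof (cases "\<Lambda> = 0")
    case True
    then show ?thesis using P(1,2)[of 0] P(3)[where n = 0] by (intro that[of "P 0"]) auto
  next
    case False
    define \<nu> where "\<nu> = measure_pmf (poisson_pmf \<Lambda>) \<bind> P"
    have 1: "prob_space \<nu>" unfolding \<nu>_def using P(1) by (intro measure_pmf.prob_space_bind[OF _ P_meas]) auto
    have "AE x in \<nu>. 0 \<le> x"
      unfolding \<nu>_def using P(2) by (subst AE_bind[OF P_meas]) (auto simp: nonneg_measureD)
    moreover have "sets \<nu> = sets borel"
      unfolding \<nu>_def by (rule sets_bind) (auto simp: sets)
    ultimately have 2: "nonneg_measure \<nu>" using 1 by (simp add: nonneg_measure_def prob_space_def)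
    have 3: "laplace \<nu> u = exp (\<Lambda> * (laplace Q u - 1))" if u: "u \<ge> 0" for u
    proof -
      let ?q = "laplace Q u"
      have q: "?q \<ge> 0" by (simp add: laplace_moment_nonneg Q)
      have s: "(\<lambda>n. \<Lambda> ^ n / fact n * exp (- \<Lambda>) * ?q ^ n) sums (exp (\<Lambda> * ?q) * exp (- \<Lambda>))"
        using sums_mult2[OF exp_converges[of "\<Lambda> * ?q"], of "exp (- \<Lambda>)"]
        by (simp add: power_mult_distrib field_simps)
      have "ennreal (laplace \<nu> u) = (\<integral>\<^sup>+n. \<integral>\<^sup>+x. ennreal (exp (- (u * x))) \<partial>P n \<partial>measure_pmf (poisson_pmf \<Lambda>))"
        unfolding nn_integral_laplace[OF 2 u, symmetric] unfolding \<nu>_def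
        by (rule nn_integral_bind[OF _ P_meas]) measurable
      also have "\<dots> = (\<integral>\<^sup>+n. ennreal (?q ^ n) \<partial>measure_pmf (poisson_pmf \<Lambda>))"
        by (simp add: nn_integral_laplace P u)
      also have "\<dots> = (\<integral>\<^sup>+n. ennreal (\<Lambda> ^ n / fact n * exp (- \<Lambda>) * ?q ^ n) \<partial>count_space UNIV)"
        unfolding nn_integral_measure_pmf using \<open>\<Lambda> \<ge> 0\<close> False q
        by (intro nn_integral_cong) (simp flip: ennreal_mult)
      also have "\<dots> = (\<Sum>n. ennreal (\<Lambda> ^ n / fact n * exp (- \<Lambda>) * ?q ^ n))"
        by (rule nn_integral_count_space_nat)
      also have "\<dots> = ennreal (exp (\<Lambda> * ?q) * exp (- \<Lambda>))"
        using s \<open>\<Lambda> \<ge> 0\<close> q by (intro suminf_ennreal_eq) auto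
      also have "exp (\<Lambda> * ?q) * exp (- \<Lambda>) = exp (\<Lambda> * (?q - 1))"
        by (simp add: algebra_simps flip: exp_add)
      finally show ?thesis by (simp add: laplace_moment_nonneg 2)
    qed
    show ?thesis by (rule that[OF 1 2 3])
  qed
qed

section \<open>The convolution equation behind the Riccati equation\<close>

text \<open>Green kernel of \<open>(1 + x) m' + p m = h\<close> on the half line:
  \<open>(1 + x) powr p\<close> is the integrating factor, and the column \<open>y = 0\<close>
  carries the initial value. Values in \<open>ennreal\<close> let the iteration run without
  integrability conditions.\<close>

definition riccati_kernel :: "real \<Rightarrow> real \<Rightarrow> real \<Rightarrow> ennreal" where
  "riccati_kernel p x y =
     (if 0 \<le> y \<and> y \<le> x then ennreal ((1 + x) powr (- p) * (1 + y) powr (p - 1)) else 0)"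

lemma riccati_kernel_measurable [measurable]:
  "(\<lambda>(x, y). riccati_kernel p x y) \<in> borel_measurable (borel \<Otimes>\<^sub>M borel)"
  unfolding riccati_kernel_def by measurable

text \<open>The weight is the formal adjoint of \<open>(1 + x) d/dx + p\<close> applied to
  \<open>exp (- (u * x))\<close>, so integrating against it undoes the kernel. The assumption
  \<open>p > 1\<close> makes the antiderivative vanish at infinity even for
  \<open>u = 0\<close>.\<close>

lemma riccati_kernel_integral:
  fixes p u y :: real
  assumes "p > 1" "u \<ge> 0" "y \<ge> 0"
  shows "(\<integral>\<^sup>+x. ennreal (exp (- (u * x)) * (u * (1 + x) + (p - 1))) * riccati_kernel p x y \<partial>lborel)
         = ennreal (exp (- (u * y)))"
proof -
  define F where "F x = - (exp (- (u * x)) * (1 + x) powr (1 - p) * (1 + y) powr (p - 1))" for x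
  define f where "f x = exp (- (u * x)) * (u * (1 + x) + (p - 1)) * ((1 + x) powr (- p) * (1 + y) powr (p - 1))" for x
  have "(\<integral>\<^sup>+x. ennreal (exp (- (u * x)) * (u * (1 + x) + (p - 1))) * riccati_kernel p x y \<partial>lborel)
      = (\<integral>\<^sup>+x. ennreal (f x) * indicator {y..} x \<partial>lborel)"
    using assms by (intro nn_integral_cong)
      (auto simp: riccati_kernel_def f_def split: split_indicator simp flip: ennreal_mult)
  also have "\<dots> = ennreal (0 - F y)"
  proof (rule nn_integral_FTC_atLeast)
    show "f \<in> borel_measurable borel" unfolding f_def by measurable
    show "0 \<le> f x" if "y \<le> x" for x using assms that by (auto simp: f_def)
    show "DERIV F x :> f x" if "y \<le> x" for x
    proof -
      have "1 + x > 0" using that assms by simp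
      then have e: "(1 + x) powr (1 - p) = (1 + x) * (1 + x) powr (- p)"
        by (simp add: powr_diff powr_minus field_simps)
      have d: "((\<lambda>x. (1 + x) powr (1 - p)) has_real_derivative (1 - p) * (1 + x) powr (- p)) (at x)"
        using \<open>1 + x > 0\<close> by (auto intro!: derivative_eq_intros)
      show ?thesis unfolding F_def f_def
        by (rule derivative_eq_intros d refl)+ (simp add: e algebra_simps)
    qed
    have "((\<lambda>x. (1 + x) powr (1 - p)) \<longlongrightarrow> 0) at_top"
      using \<open>p > 1\<close> by (intro tendsto_neg_powr filterlim_tendsto_add_at_top[OF tendsto_const filterlim_ident]) auto
    then have "((\<lambda>x. (1 + x) powr (1 - p) * (1 + y) powr (p - 1)) \<longlongrightarrow> 0) at_top"
      by (rule tendsto_mult_left_zero)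
    moreover have "\<forall>\<^sub>F x in at_top. norm (F x) \<le> (1 + x) powr (1 - p) * (1 + y) powr (p - 1)"
      using eventually_ge_at_top[of 0]
    proof eventually_elim
      case (elim x)
      then show ?case using \<open>u \<ge> 0\<close>
        by (auto simp: F_def abs_mult mult.assoc intro!: mult_left_le_one_le)
    qed
    ultimately show "(F \<longlongrightarrow> 0) at_top" by (rule Lim_null_comparison[rotated])
  qed
  also have "0 - F y = exp (- (u * y))"
    using assms by (simp add: F_def mult.assoc flip: powr_add)
  finally show ?thesis .
qed

text \<open>Tonelli and the shift \<open>x \<mapsto> y + x\<close>. Infinite values are permitted,
  so this applies to the iterates before their mass is known to be finite.\<close>

lemma nn_integral_exp_convolution:
  fixes f g :: "real \<Rightarrow> ennreal"
  assumes [measurable]: "f \<in> borel_measurable borel" "g \<in> borel_measurable borel"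
  shows "(\<integral>\<^sup>+x. ennreal (exp (- (u * x))) * (\<integral>\<^sup>+y. f y * g (x - y) \<partial>lborel) \<partial>lborel)
    = (\<integral>\<^sup>+x. ennreal (exp (- (u * x))) * f x \<partial>lborel) * (\<integral>\<^sup>+x. ennreal (exp (- (u * x))) * g x \<partial>lborel)"
proof -
  have "(\<integral>\<^sup>+x. ennreal (exp (- (u * x))) * (\<integral>\<^sup>+y. f y * g (x - y) \<partial>lborel) \<partial>lborel)
     = (\<integral>\<^sup>+x. \<integral>\<^sup>+y. ennreal (exp (- (u * x))) * (f y * g (x - y)) \<partial>lborel \<partial>lborel)"
    by (simp add: nn_integral_cmult)
  also have "\<dots> = (\<integral>\<^sup>+y. \<integral>\<^sup>+x. ennreal (exp (- (u * x))) * (f y * g (x - y)) \<partial>lborel \<partial>lborel)"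
    by (rule lborel_pair.Fubini') measurable
  also have "\<dots> = (\<integral>\<^sup>+y. (ennreal (exp (- (u * y))) * f y) * (\<integral>\<^sup>+x. ennreal (exp (- (u * x))) * g x \<partial>lborel) \<partial>lborel)"
  proof (rule nn_integral_cong)
    fix y :: real
    have "(\<integral>\<^sup>+x. ennreal (exp (- (u * x))) * (f y * g (x - y)) \<partial>lborel)
        = ennreal \<bar>1\<bar> * (\<integral>\<^sup>+x. ennreal (exp (- (u * (y + 1 * x)))) * (f y * g (y + 1 * x - y)) \<partial>lborel)"
      by (rule nn_integral_real_affine) auto
    also have "\<dots> = (\<integral>\<^sup>+x. (ennreal (exp (- (u * y))) * f y) * (ennreal (exp (- (u * x))) * g x) \<partial>lborel)"
    proof (simp, rule nn_integral_cong)
      fix x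
      have "ennreal (exp (- (u * (y + x)))) = ennreal (exp (- (u * y))) * ennreal (exp (- (u * x)))"
        by (simp add: distrib_left flip: ennreal_mult exp_add)
      then show "ennreal (exp (- (u * (y + x)))) * (f y * g x) =
          ennreal (exp (- (u * y))) * f y * (ennreal (exp (- (u * x))) * g x)"
        by (simp add: mult_ac)
    qed
    also have "\<dots> = (ennreal (exp (- (u * y))) * f y) * (\<integral>\<^sup>+x. ennreal (exp (- (u * x))) * g x \<partial>lborel)"
      by (rule nn_integral_cmult) measurable
    finally show "(\<integral>\<^sup>+x. ennreal (exp (- (u * x))) * (f y * g (x - y)) \<partial>lborel) = \<dots>" .
  qed
  also have "\<dots> = (\<integral>\<^sup>+x. ennreal (exp (- (u * x))) * f x \<partial>lborel) * (\<integral>\<^sup>+x. ennreal (exp (- (u * x))) * g x \<partial>lborel)"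
    by (rule nn_integral_multc) measurable
  finally show ?thesis .
qed

text \<open>Picard iterates, started at 0, for the equation
  \<open>(1 + x) m' + (1 + 2 a + b) m = m * m\<close>, \<open>m 0 = a (a + b)\<close>, in mild form.\<close>
primrec riccati_iter :: "real \<Rightarrow> real \<Rightarrow> nat \<Rightarrow> real \<Rightarrow> ennreal" where
  "riccati_iter a b 0 = (\<lambda>x. 0)"
| "riccati_iter a b (Suc n) = (\<lambda>x. ennreal (a * (a + b)) * riccati_kernel (1 + 2 * a + b) x 0 +
     (\<integral>\<^sup>+y. riccati_kernel (1 + 2 * a + b) x y *
        (\<integral>\<^sup>+z. riccati_iter a b n z * riccati_iter a b n (y - z) \<partial>lborel) \<partial>lborel))"

lemma riccati_iter_measurable [measurable]: "riccati_iter a b n \<in> borel_measurable borel"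
proof (induction n)
  case (Suc n)
  note [measurable] = Suc
  have "(\<lambda>x. riccati_kernel (1 + 2 * a + b) x 0) \<in> borel_measurable borel"
    unfolding riccati_kernel_def by measurable
  note [measurable] = this
  show ?case by simp
qed simp

lemma riccati_iter_neg: "x < 0 \<Longrightarrow> riccati_iter a b n x = 0"
proof (cases n)
  case (Suc k)
  assume "x < 0"
  then have "riccati_kernel p x y = 0" for p y by (auto simp: riccati_kernel_def)
  then show ?thesis by (simp add: Suc)
qed simp

lemma riccati_iter_mono: "riccati_iter a b n x \<le> riccati_iter a b (Suc n) x"
proof (induction n arbitrary: x)
  case (Suc n)
  show ?case
    by (subst (1 2) riccati_iter.simps(2))
       (intro add_left_mono nn_integral_mono mult_left_mono mult_mono Suc zero_le)
qed simp

text \<open>Testing the mild equation against the adjoint weight cancels the kernel and turns the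
  convolution into a square. What remains is an algebraic relation between consecutive iterates, and
  at \<open>u = 0\<close> a recursion for their masses.\<close>

lemma riccati_iter_laplace:
  fixes a b u :: real
  assumes "a > 0" "b > 0" "u \<ge> 0"
  shows "(\<integral>\<^sup>+x. ennreal (exp (- (u * x)) * (u * (1 + x) + (2 * a + b))) * riccati_iter a b (Suc n) x \<partial>lborel)
    = ennreal (a * (a + b)) + (\<integral>\<^sup>+x. ennreal (exp (- (u * x))) * riccati_iter a b n x \<partial>lborel)\<^sup>2"
proof -
  let ?p = "1 + 2 * a + b"
  let ?w = "\<lambda>x. ennreal (exp (- (u * x)) * (u * (1 + x) + (?p - 1)))"
  let ?c = "\<lambda>y. \<integral>\<^sup>+z. riccati_iter a b n z * riccati_iter a b n (y - z) \<partial>lborel"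
  have K: "(\<integral>\<^sup>+x. ?w x * riccati_kernel ?p x y \<partial>lborel) = ennreal (exp (- (u * y)))" if "y \<ge> 0" for y
    by (rule riccati_kernel_integral) (use assms that in auto)
  have [measurable]: "(\<lambda>x. riccati_kernel ?p x 0) \<in> borel_measurable borel"
    unfolding riccati_kernel_def by measurable
  have "(\<integral>\<^sup>+x. ?w x * riccati_iter a b (Suc n) x \<partial>lborel) =
     (\<integral>\<^sup>+x. ennreal (a * (a + b)) * (?w x * riccati_kernel ?p x 0) +
        (\<integral>\<^sup>+y. ?w x * riccati_kernel ?p x y * ?c y \<partial>lborel) \<partial>lborel)"
  proof (rule nn_integral_cong)
    fix x :: real
    have "?w x * (\<integral>\<^sup>+y. riccati_kernel ?p x y * ?c y \<partial>lborel) = (\<integral>\<^sup>+y. ?w x * (riccati_kernel ?p x y * ?c y) \<partial>lborel)"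
      by (rule nn_integral_cmult[symmetric]) measurable
    then show "?w x * riccati_iter a b (Suc n) x = ennreal (a * (a + b)) * (?w x * riccati_kernel ?p x 0) +
        (\<integral>\<^sup>+y. ?w x * riccati_kernel ?p x y * ?c y \<partial>lborel)"
      by (simp add: distrib_left mult.assoc mult.left_commute)
  qed
  also have "\<dots> = ennreal (a * (a + b)) * (\<integral>\<^sup>+x. ?w x * riccati_kernel ?p x 0 \<partial>lborel) +
     (\<integral>\<^sup>+x. \<integral>\<^sup>+y. ?w x * riccati_kernel ?p x y * ?c y \<partial>lborel \<partial>lborel)"
    by (subst nn_integral_add) (auto simp: nn_integral_cmult)
  also have "(\<integral>\<^sup>+x. \<integral>\<^sup>+y. ?w x * riccati_kernel ?p x y * ?c y \<partial>lborel \<partial>lborel)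
      = (\<integral>\<^sup>+y. \<integral>\<^sup>+x. ?w x * riccati_kernel ?p x y * ?c y \<partial>lborel \<partial>lborel)"
    by (rule lborel_pair.Fubini') measurable
  also have "\<dots> = (\<integral>\<^sup>+y. (\<integral>\<^sup>+x. ?w x * riccati_kernel ?p x y \<partial>lborel) * ?c y \<partial>lborel)"
    by (intro nn_integral_cong nn_integral_multc) measurable
  also have "\<dots> = (\<integral>\<^sup>+y. ennreal (exp (- (u * y))) * ?c y \<partial>lborel)"
  proof (rule nn_integral_cong)
    fix y :: real
    show "(\<integral>\<^sup>+x. ?w x * riccati_kernel ?p x y \<partial>lborel) * ?c y = ennreal (exp (- (u * y))) * ?c y"
    proof (cases "y \<ge> 0")
      \<comment> \<open>\<open>K\<close> covers only \<open>y \<ge> 0\<close>. For negative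
        \<open>y\<close> one of \<open>z\<close> and \<open>y - z\<close> is negative, so the
        convolution vanishes.\<close>
      case False
      have "?c y = (\<integral>\<^sup>+z. 0 \<partial>(lborel :: real measure))"
      proof (rule nn_integral_cong)
        fix z :: real
        show "riccati_iter a b n z * riccati_iter a b n (y - z) = 0"
          using False by (cases "z < 0") (auto simp: riccati_iter_neg)
      qed
      then show ?thesis by simp
    qed (simp only: K)
  qed
  also have "\<dots> = (\<integral>\<^sup>+x. ennreal (exp (- (u * x))) * riccati_iter a b n x \<partial>lborel)\<^sup>2"
    by (simp add: nn_integral_exp_convolution power2_eq_square)
  finally show ?thesis using K[of 0] by simp
qed

text \<open>The mass recursion sends \<open>A\<close> to
  \<open>(a * (a + b) + A\<^sup>2) / (2 * a + b)\<close>. This map is increasing on the half line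
  and fixes \<open>a\<close>, so the bound \<open>a\<close> is inherited from the zero
  start.\<close>

lemma riccati_iter_mass:
  fixes a b :: real
  assumes "a > 0" "b > 0"
  shows "(\<integral>\<^sup>+x. riccati_iter a b n x \<partial>lborel) \<le> ennreal a"
proof (induction n)
  case (Suc n)
  have "ennreal (2 * a + b) * (\<integral>\<^sup>+x. riccati_iter a b (Suc n) x \<partial>lborel)
      = ennreal (a * (a + b)) + (\<integral>\<^sup>+x. riccati_iter a b n x \<partial>lborel)\<^sup>2"
    using riccati_iter_laplace[of a b 0 n] assms
    by (simp add: nn_integral_cmult del: riccati_iter.simps)
  also have "\<dots> \<le> ennreal (a * (a + b)) + (ennreal a)\<^sup>2"
    using Suc by (intro add_left_mono power_mono) auto
  also have "\<dots> = ennreal (2 * a + b) * ennreal a"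
    using assms by (simp add: power2_eq_square algebra_simps flip: ennreal_mult ennreal_plus)
  finally show ?case
    using assms by (subst (asm) ennreal_mult_le_mult_iff) auto
qed simp

text \<open>The total mass solves \<open>(A - a) (A - a - b) = 0\<close>, and starting the iteration
  at 0 selects the smaller root.\<close>
lemma riccati_measure:
  fixes a b :: real
  assumes ab: "a > 0" "b > 0"
  obtains N where "nonneg_measure N" "measure N UNIV = a"
    "\<And>u. u > 0 \<Longrightarrow> u * laplace_moment 1 N u = (laplace N u - a) * (laplace N u - a - b) - u * laplace N u"
proof -
  define m where "m x = (SUP n. riccati_iter a b n x)" for x
  have [measurable]: "m \<in> borel_measurable borel" unfolding m_def by measurable
  have inc: "incseq (riccati_iter a b)"
    by (rule incseq_SucI) (auto simp: le_fun_def riccati_iter_mono simp del: riccati_iter.simps)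
  define N where "N = density lborel m"
  have sets: "sets N = sets borel" and sp: "space N = UNIV" by (simp_all add: N_def)
  \<comment> \<open>Monotone convergence is recorded as a limit rather than a supremum, because the
    relation between iterates \<open>n\<close> and \<open>Suc n\<close> contains a square, through
    which limits pass directly.\<close>
  have int_m: "(\<lambda>n. \<integral>\<^sup>+x. g x * riccati_iter a b n x \<partial>lborel) \<longlonglongrightarrow> (\<integral>\<^sup>+x. g x \<partial>N)"
    if [measurable]: "g \<in> borel_measurable borel" for g
  proof -
    have i: "incseq (\<lambda>n x. g x * riccati_iter a b n x)"
      using inc by (auto simp: incseq_def le_fun_def intro!: mult_left_mono)
    have "(\<integral>\<^sup>+x. g x \<partial>N) = (\<integral>\<^sup>+x. (SUP n. g x * riccati_iter a b n x) \<partial>lborel)"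
      by (simp add: N_def nn_integral_density m_def SUP_mult_left_ennreal mult.commute)
    also have "\<dots> = (SUP n. \<integral>\<^sup>+x. g x * riccati_iter a b n x \<partial>lborel)"
      by (rule nn_integral_monotone_convergence_SUP[OF i]) measurable
    finally show ?thesis
      using i by (auto intro!: LIMSEQ_SUP simp: incseq_def le_fun_def intro!: nn_integral_mono)
  qed
  have mass: "emeasure N UNIV \<le> ennreal a"
  proof (rule LIMSEQ_le_const2)
    show "(\<lambda>n. \<integral>\<^sup>+x. 1 * riccati_iter a b n x \<partial>lborel) \<longlonglongrightarrow> emeasure N UNIV"
      using int_m[of "\<lambda>x. 1"] by (simp add: sp)
    show "\<exists>N. \<forall>n\<ge>N. (\<integral>\<^sup>+x. 1 * riccati_iter a b n x \<partial>lborel) \<le> ennreal a"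
      using riccati_iter_mass[OF ab] by auto
  qed
  have "(\<lambda>n. \<integral>\<^sup>+x. indicator {..<0} x * riccati_iter a b n x \<partial>lborel) \<longlonglongrightarrow> emeasure N {..<0}"
    using int_m[of "indicator {..<0}"] by (simp add: sets)
  moreover have "(\<integral>\<^sup>+x. indicator {..<0} x * riccati_iter a b n x \<partial>lborel) = (\<integral>\<^sup>+x. 0 \<partial>(lborel::real measure))" for n
    by (intro nn_integral_cong) (auto simp: riccati_iter_neg split: split_indicator)
  ultimately have "emeasure N {..<0} = 0"
    by (simp add: LIMSEQ_const_iff)
  then have "AE x in N. 0 \<le> x"
    by (intro AE_I[of _ _ "{..<0}"]) (auto simp: not_le sets)
  moreover have "finite_measure N"
    using mass by (intro finite_measureI) (auto simp: sp top_unique)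
  ultimately have N: "nonneg_measure N" by (simp add: nonneg_measure_def sets)
  interpret finite_measure N using N by (rule nonneg_measureD)
  have eq: "(\<integral>\<^sup>+x. ennreal (exp (- (u * x)) * (u * (1 + x) + (2 * a + b))) \<partial>N)
      = ennreal (a * (a + b)) + (ennreal (laplace N u))\<^sup>2" if u: "u \<ge> 0" for u
  proof (rule LIMSEQ_unique)
    show "(\<lambda>n. \<integral>\<^sup>+x. ennreal (exp (- (u * x)) * (u * (1 + x) + (2 * a + b))) * riccati_iter a b (Suc n) x \<partial>lborel)
       \<longlonglongrightarrow> (\<integral>\<^sup>+x. ennreal (exp (- (u * x)) * (u * (1 + x) + (2 * a + b))) \<partial>N)"
      by (rule LIMSEQ_Suc[OF int_m]) measurable
    have "(\<lambda>n. \<integral>\<^sup>+x. ennreal (exp (- (u * x))) * riccati_iter a b n x \<partial>lborel) \<longlonglongrightarrow> ennreal (laplace N u)"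
      using int_m[of "\<lambda>x. ennreal (exp (- (u * x)))"] by (simp add: nn_integral_laplace N u)
    then show "(\<lambda>n. \<integral>\<^sup>+x. ennreal (exp (- (u * x)) * (u * (1 + x) + (2 * a + b))) * riccati_iter a b (Suc n) x \<partial>lborel)
       \<longlonglongrightarrow> ennreal (a * (a + b)) + (ennreal (laplace N u))\<^sup>2"
      unfolding riccati_iter_laplace[OF ab u] power2_eq_square
      by (intro tendsto_add tendsto_const tendsto_mult_ennreal) auto
  qed
  define A where "A = measure N UNIV"
  have A: "laplace N 0 = A" "A \<ge> 0" "A \<le> a" "emeasure N UNIV = ennreal A"
    using mass ab by (auto simp: A_def laplace_moment_def sp emeasure_eq_measure)
  have "ennreal ((2 * a + b) * A) = ennreal (a * (a + b) + A\<^sup>2)"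
    using eq[of 0] A ab by (simp add: sp ennreal_mult ennreal_plus ennreal_power)
  then have "(2 * a + b) * A = a * (a + b) + A\<^sup>2"
    using A ab by (subst (asm) ennreal_inj) auto
  then have "(A - a) * (A - a - b) = 0" by (simp add: power2_eq_square algebra_simps)
  then have "A = a" using \<open>A \<le> a\<close> ab by auto
  moreover have "u * laplace_moment 1 N u = (laplace N u - a) * (laplace N u - a - b) - u * laplace N u"
    if u: "u > 0" for u
  proof -
    let ?M = "laplace N u" and ?C = "laplace_moment 1 N u"
    have nn: "?M \<ge> 0" "?C \<ge> 0" by (simp_all add: laplace_moment_nonneg N)
    have i0: "integrable N (\<lambda>x. exp (- (u * x)))" and i1: "integrable N (\<lambda>x. x * exp (- (u * x)))"
      using integrable_laplace[OF N, of u] integrable_laplace_moment[OF N u, of 1] u by auto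
    \<comment> \<open>Up to this point the identity contains no subtraction, so it could stay in
      \<open>ennreal\<close>; it moves to the reals before being rearranged.\<close>
    have "ennreal (a * (a + b) + ?M\<^sup>2) = (\<integral>\<^sup>+x. ennreal (exp (- (u * x)) * (u * (1 + x) + (2 * a + b))) \<partial>N)"
      using eq[of u] u nn ab by (simp add: ennreal_plus ennreal_power)
    also have "\<dots> = (\<integral>\<^sup>+x. ennreal ((u + 2 * a + b) * exp (- (u * x)) + u * (x * exp (- (u * x)))) \<partial>N)"
      by (simp add: algebra_simps)
    also have "\<dots> = ennreal (\<integral>x. ((u + 2 * a + b) * exp (- (u * x)) + u * (x * exp (- (u * x)))) \<partial>N)"
      using nonneg_measureD(3)[OF N] i0 i1 u ab
      by (intro nn_integral_eq_integral) (auto elim!: eventually_mono)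
    also have "(\<integral>x. ((u + 2 * a + b) * exp (- (u * x)) + u * (x * exp (- (u * x)))) \<partial>N) = (u + 2 * a + b) * ?M + u * ?C"
      using i0 i1 by (simp add: laplace_moment_def)
    finally have "a * (a + b) + ?M\<^sup>2 = (u + 2 * a + b) * ?M + u * ?C"
      using nn u ab by (subst (asm) ennreal_inj) auto
    then show ?thesis by (simp add: power2_eq_square algebra_simps)
  qed
  ultimately show thesis using that[OF N] by (auto simp: A_def)
qed

section \<open>Measurability and positivity of Laplace transforms\<close>

lemma laplace_measurable:
  assumes M: "nonneg_measure M"
  shows "laplace_moment k M \<in> borel_measurable borel"
proof -
  interpret finite_measure M using M by (rule nonneg_measureD)
  note [measurable_cong] = nonneg_measureD(2)[OF M]
  show ?thesis unfolding laplace_moment_def by measurable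
qed

lemma laplace_pos:
  assumes "prob_space M" and M: "nonneg_measure M" and "u \<ge> 0"
  shows "laplace M u > 0"
proof -
  interpret prob_space M by fact
  note [measurable_cong] = nonneg_measureD(2)[OF M]
  have "laplace M u \<noteq> 0"
  proof
    assume "laplace M u = 0"
    then have "AE x in M. exp (- (u * x)) = 0"
      using integrable_laplace[OF M \<open>u \<ge> 0\<close>]
      by (subst (asm) laplace_moment_def, subst (asm) integral_nonneg_eq_0_iff_AE) auto
    then show False using AE_False not_empty by simp
  qed
  then show ?thesis using laplace_moment_nonneg[OF M, of 0 u] by simp
qed

section \<open>Beta prime laws and Kummer's equation\<close>

definition beta_prime_weight :: "real \<Rightarrow> real \<Rightarrow> real \<Rightarrow> real" where
  "beta_prime_weight a b x = indicator {0<..} x * x powr (a - 1) * (1 + x) powr (- (a + b))"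

definition beta_prime :: "real \<Rightarrow> real \<Rightarrow> real measure" where
  "beta_prime a b = density lborel (\<lambda>x. ennreal (beta_prime_weight a b x / Beta a b))"

lemma beta_prime_weight_measurable [measurable]: "beta_prime_weight a b \<in> borel_measurable borel"
  unfolding beta_prime_weight_def by measurable

lemma beta_prime_weight_nonneg: "beta_prime_weight a b x \<ge> 0"
  by (simp add: beta_prime_weight_def)

lemma Beta_real_pos: "a > 0 \<Longrightarrow> b > 0 \<Longrightarrow> Beta a b > (0 :: real)"
  by (simp add: Beta_def)

lemma nonneg_measure_beta_prime:
  assumes "prob_space (beta_prime a b)"
  shows "nonneg_measure (beta_prime a b)"
proof -
  have "AE x in beta_prime a b. 0 \<le> x"
    unfolding beta_prime_def
    by (subst AE_density) (auto simp: beta_prime_weight_def split: split_indicator intro!: AE_I2)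
  moreover have "sets (beta_prime a b) = sets borel" by (simp add: beta_prime_def)
  ultimately show ?thesis using assms by (simp add: nonneg_measure_def prob_space_def)
qed

text \<open>The function \<open>F\<close> in the proof is the weight multiplied by
  \<open>x * (1 + x) * exp (- (u * x))\<close>. It vanishes at both ends, so its derivative
  integrates to 0; that derivative is the exponentially damped weight times a quadratic polynomial
  in \<open>x\<close>, whose coefficients are those of the equation.\<close>

lemma beta_prime_kummer:
  fixes a b u :: real
  assumes ab: "a > 0" "b \<ge> 1" and pr: "prob_space (beta_prime a b)" and u: "u > 0"
  shows "u * laplace_moment 2 (beta_prime a b) u =
    a * laplace (beta_prime a b) u + (1 - b - u) * laplace_moment 1 (beta_prime a b) u"
proof -
  let ?M = "beta_prime a b" and ?g = "beta_prime_weight a b"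
  define B where "B = Beta a b"
  have B: "B > 0" unfolding B_def by (rule Beta_real_pos) (use ab in auto)
  note M = nonneg_measure_beta_prime[OF pr]
  have i: "integrable lborel (\<lambda>x. ?g x / B * (x ^ k * exp (- (u * x))))" for k
    using integrable_laplace_moment[OF M u, of k] B beta_prime_weight_nonneg
    unfolding beta_prime_def B_def by (subst (asm) integrable_density) auto
  have lm: "laplace_moment k ?M u = (\<integral>x. ?g x * (x ^ k * exp (- (u * x))) \<partial>lborel) / B" for k
    unfolding laplace_moment_def beta_prime_def
    using B beta_prime_weight_nonneg
    by (subst integral_density) (auto simp: B_def)
  have i': "integrable lborel (\<lambda>x. ?g x * (x ^ k * exp (- (u * x))))" for k
    using integrable_mult_right[OF i[of k], of B] B by simp
  define F where "F x = x powr a * (1 + x) powr (1 - a - b) * exp (- (u * x))" for x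
  define f where "f x = (a + (1 - b - u) * x - u * x\<^sup>2) * (x powr (a - 1) * (1 + x) powr (- (a + b)) * exp (- (u * x)))" for x
  have fg: "indicator {0<..} x *\<^sub>R f x = a * (?g x * (x ^ 0 * exp (- (u * x)))) +
      (1 - b - u) * (?g x * (x ^ 1 * exp (- (u * x)))) - u * (?g x * (x ^ 2 * exp (- (u * x))))" for x
    by (auto simp: f_def beta_prime_weight_def algebra_simps split: split_indicator)
  have "(LBINT x=0..\<infinity>. f x) = 0 - 0"
  proof (rule interval_integral_FTC_integrable)
    show "(0::ereal) < \<infinity>" by simp
    show "(F has_vector_derivative f x) (at x)" if "0 < ereal x" for x
    proof -
      have x: "x > 0" using that by simp
      have e: "x powr a = x * x powr (a - 1)"
        "(1 + x) powr (1 - a - b) = (1 + x) * (1 + x) powr (- (a + b))"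
        using x by (simp_all add: powr_diff powr_minus powr_add field_simps)
      have d: "((\<lambda>x. x powr a) has_real_derivative a * x powr (a - 1)) (at x)"
        "((\<lambda>x. (1 + x) powr (1 - a - b)) has_real_derivative (1 - a - b) * (1 + x) powr (- (a + b))) (at x)"
        using x by (auto intro!: derivative_eq_intros simp: algebra_simps)
      have "(F has_real_derivative f x) (at x)"
        unfolding F_def f_def
        by (rule d derivative_eq_intros refl)+ (simp only: e, simp add: power2_eq_square algebra_simps)
      then show ?thesis by (simp add: has_real_derivative_iff_has_vector_derivative)
    qed
    show "isCont f x" if "0 < ereal x" for x
      unfolding f_def using that by (intro continuous_intros) auto
    show "set_integrable lborel (einterval 0 \<infinity>) f"
    proof -
      have "einterval 0 \<infinity> = {0 :: real <..}" by (auto simp: einterval_def)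
      then show ?thesis
        unfolding set_integrable_def
        by (simp only: fg) (intro Bochner_Integration.integrable_add Bochner_Integration.integrable_diff integrable_mult_right i')
    qed
    have "((\<lambda>x :: real. x powr a) \<longlongrightarrow> 0) (at_right 0)"
      by (rule tendsto_zero_powrI[where b = a]) (use ab in \<open>auto intro!: tendsto_intros simp: eventually_at_filter\<close>)
    moreover have "\<forall>\<^sub>F x in at_right 0. norm (F x) \<le> x powr a"
      using eventually_at_right_less[of 0]
    proof eventually_elim
      case (elim x)
      have "(1 + x) powr (1 - a - b) \<le> 1 powr (1 - a - b)"
        using elim ab by (intro powr_mono2') auto
      then have "(1 + x) powr (1 - a - b) * exp (- (u * x)) \<le> 1 * 1"
        using elim u by (intro mult_mono) auto
      from mult_left_mono[OF this, of "x powr a"] show ?case by (simp add: F_def abs_mult mult.assoc)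
    qed
    ultimately have "(F \<longlongrightarrow> 0) (at_right 0)" by (rule Lim_null_comparison[rotated])
    then show "((F \<circ> real_of_ereal) \<longlongrightarrow> 0) (at_right 0)"
      by (simp add: zero_ereal_def ereal_tendsto_simps)
    have "((\<lambda>x :: real. exp (- (u * x))) \<longlongrightarrow> 0) at_top"
      by (intro filterlim_compose[OF exp_at_bot] filterlim_compose[OF filterlim_uminus_at_bot_at_top]
          filterlim_tendsto_pos_mult_at_top[OF tendsto_const u filterlim_ident])
    moreover have "\<forall>\<^sub>F x in at_top. norm (F x) \<le> exp (- (u * x))"
      using eventually_ge_at_top[of 0]
    proof eventually_elim
      case (elim x)
      \<comment> \<open>Replacing \<open>x powr a\<close> by \<open>(1 + x) powr a\<close> lets the
        exponents add up to \<open>1 - b\<close>, which is nonpositive by \<open>b \<ge> 1\<close>;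
        the exponential then gives the decay.\<close>
      have "x powr a * (1 + x) powr (1 - a - b) \<le> (1 + x) powr a * (1 + x) powr (1 - a - b)"
        using elim ab by (intro mult_right_mono powr_mono2) auto
      also have "\<dots> = (1 + x) powr (1 - b)" by (simp flip: powr_add)
      also have "\<dots> \<le> 1 powr (1 - b)"
        using elim ab by (intro powr_mono2') auto
      finally show ?case by (simp add: F_def abs_mult)
    qed
    ultimately have "(F \<longlongrightarrow> 0) at_top" by (rule Lim_null_comparison[rotated])
    then show "((F \<circ> real_of_ereal) \<longlongrightarrow> 0) (at_left \<infinity>)"
      by (simp add: ereal_tendsto_simps)
  qed
  then have "(\<integral>x. indicator {0<..} x *\<^sub>R f x \<partial>lborel) = 0"
    using interval_integral_to_infinity_eq[where a = 0 and f = f]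
    by (simp add: zero_ereal_def set_lebesgue_integral_def)
  also have "(\<integral>x. indicator {0<..} x *\<^sub>R f x \<partial>lborel) =
      a * (B * laplace ?M u) + (1 - b - u) * (B * laplace_moment 1 ?M u) - u * (B * laplace_moment 2 ?M u)"
    unfolding fg lm using B
    by (simp only: Bochner_Integration.integral_diff Bochner_Integration.integral_add
        Bochner_Integration.integrable_add integrable_mult_right i' integral_mult_right_zero) simp
  finally have "B * (u * laplace_moment 2 ?M u) = B * (a * laplace ?M u + (1 - b - u) * laplace_moment 1 ?M u)"
    by (simp add: algebra_simps)
  then show ?thesis using B by simp
qed

text \<open>With \<open>\<chi> = - \<phi>'\<close>, the difference \<open>R = \<chi> - \<psi> \<phi>\<close> solves \<open>u R' = (b - 1 + u + u \<psi>) R\<close>,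
  whose nonzero solutions grow at least like \<open>exp u\<close>, whereas \<open>R\<close> is bounded on \<open>{1..}\<close>.\<close>
lemma log_derivative_laplace:
  fixes a b :: real
  assumes ab: "a > 0" "b \<ge> 1" and pr: "prob_space \<mu>" and mu: "nonneg_measure \<mu>"
    and N: "nonneg_measure N" "measure N UNIV = a"
    and kummer: "\<And>u. u > 0 \<Longrightarrow> u * laplace_moment 2 \<mu> u = a * laplace \<mu> u + (1 - b - u) * laplace_moment 1 \<mu> u"
    and ric: "\<And>u. u > 0 \<Longrightarrow> u * laplace_moment 1 N u = (laplace N u - a) * (laplace N u - a - b) - u * laplace N u"
    and u: "u > 0"
  shows "u * laplace_moment 1 \<mu> u = (a - laplace N u) * laplace \<mu> u"
proof -
  define \<psi> where "\<psi> u = (a - laplace N u) / u" for u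
  define R where "R u = laplace_moment 1 \<mu> u - \<psi> u * laplace \<mu> u" for u
  \<comment> \<open>Squaring removes the unknown sign of \<open>R\<close>, and
    \<open>exp (- u)\<close> divides out the growth that its equation forces. Thus \<open>G\<close>
    is nondecreasing, yet it is bounded by a function tending to 0.\<close>
  define G where "G u = (R u * exp (- u))\<^sup>2" for u
  have M_le: "laplace N v \<le> a" if "v > 0" for v
    using laplace_le_mass[OF N(1), of v] N(2) that by simp
  have psi: "\<psi> v \<ge> 0" "laplace N v = a - v * \<psi> v" if "v > 0" for v
    using M_le[OF that] that by (auto simp: \<psi>_def)
  have deriv: "\<exists>D. (G has_real_derivative D) (at v) \<and> D \<ge> 0" if v: "v > 0" for v
  proof -
    let ?\<phi> = "laplace \<mu> v" and ?\<chi> = "laplace_moment 1 \<mu> v" and ?\<chi>2 = "laplace_moment 2 \<mu> v"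
      and ?M = "laplace N v" and ?M1 = "laplace_moment 1 N v"
    define p where "p = \<psi> v"
    define q where "q = (?M1 * v - (a - ?M)) / v\<^sup>2"
    have d\<psi>: "(\<psi> has_real_derivative q) (at v)"
      unfolding \<psi>_def q_def
      by (rule has_derivative_laplace_moment[OF N(1) v] derivative_eq_intros refl)+
         (use v in \<open>auto simp: power2_eq_square\<close>)
    have d\<chi>: "(laplace_moment 1 \<mu> has_real_derivative - ?\<chi>2) (at v)"
      using has_derivative_laplace_moment[OF mu v, of 1] by (simp add: numeral_2_eq_2)
    have d\<phi>: "(laplace \<mu> has_real_derivative - ?\<chi>) (at v)"
      using has_derivative_laplace_moment[OF mu v, of 0] by simp
    define D where "D = - ?\<chi>2 - (q * ?\<phi> - p * ?\<chi>)"
    have dR: "(R has_real_derivative D) (at v)"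
      unfolding R_def D_def p_def by (rule d\<psi> d\<chi> d\<phi> derivative_eq_intros refl)+ (simp add: algebra_simps)
    have M: "?M = a - v * p" using psi(2)[OF v] by (simp add: p_def)
    \<comment> \<open>In terms of \<open>p\<close> the product \<open>(M - a) * (M - a - b)\<close>
      is \<open>v * p * (v * p + b)\<close>, so the singular factor \<open>v\<close>
      cancels.\<close>
    have "v * ?M1 = v * (v * p\<^sup>2 + b * p - a + v * p)"
      unfolding ric[OF v] M by (simp add: power2_eq_square algebra_simps)
    then have M1: "?M1 = v * p\<^sup>2 + b * p - a + v * p" using v by simp
    have vq: "v * q = v * p\<^sup>2 + (b - 1) * p - a + v * p"
      unfolding q_def M1 M using v by (simp add: power2_eq_square field_simps)
    have "v * D = - (v * ?\<chi>2) - ((v * q) * ?\<phi> - v * p * ?\<chi>)"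
      by (simp add: D_def algebra_simps)
    also have "\<dots> = (b - 1 + v + v * p) * R v"
      unfolding kummer[OF v] vq by (simp add: R_def p_def power2_eq_square algebra_simps)
    finally have vD: "v * D = (b - 1 + v + v * p) * R v" .
    have "(G has_real_derivative 2 * (R v * exp (- v)) * (D * exp (- v) - R v * exp (- v))) (at v)"
      unfolding G_def by (rule dR derivative_eq_intros refl)+ simp
    moreover have "2 * (R v * exp (- v)) * (D * exp (- v) - R v * exp (- v)) \<ge> 0"
    proof -
      have "v * (R v * D - R v * R v) = (b - 1 + v * p) * (R v)\<^sup>2"
      proof -
        have "v * (R v * D - R v * R v) = R v * (v * D) - v * (R v)\<^sup>2"
          by (simp add: power2_eq_square algebra_simps)
        then show ?thesis unfolding vD by (simp add: power2_eq_square algebra_simps)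
      qed
      also have "\<dots> \<ge> 0" using ab v psi(1)[OF v] by (simp add: p_def)
      finally have "R v * D - R v * R v \<ge> 0" using v by (simp add: zero_le_mult_iff)
      then have "2 * exp (- v) * exp (- v) * (R v * D - R v * R v) \<ge> 0" by simp
      then show ?thesis by (simp add: algebra_simps)
    qed
    ultimately show ?thesis by blast
  qed
  have mono: "G u \<le> G v" if "u \<le> v" for v
    by (rule DERIV_nonneg_imp_nondecreasing[OF that], rule deriv) (use u in simp)
  \<comment> \<open>On \<open>{1..}\<close> both terms of \<open>R\<close> are nonnegative: the
    first is at most its value at 1, the second at most \<open>a\<close>.\<close>
  define C where "C = laplace_moment 1 \<mu> 1 + a"
  have bound: "G v \<le> C\<^sup>2 * exp (- v)" if v: "v \<ge> 1" for v
  proof -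
    have 1: "laplace_moment 1 \<mu> v \<ge> 0" "laplace_moment 1 \<mu> v \<le> laplace_moment 1 \<mu> 1"
      using laplace_moment_le[OF mu, of 1 v 1] laplace_moment_nonneg[OF mu] v by auto
    have 2: "laplace \<mu> v \<ge> 0" "laplace \<mu> v \<le> 1"
      using laplace_le_mass[OF mu, of v] prob_space.prob_le_1[OF pr, of UNIV] laplace_moment_nonneg[OF mu] v
      by (auto intro: order_trans)
    have "\<psi> v \<le> a / 1"
      unfolding \<psi>_def using v ab laplace_moment_nonneg[OF N(1), of 0 v] M_le[of v] by (intro frac_le) auto
    then have "\<psi> v * laplace \<mu> v \<le> a * 1" using 2 ab by (intro mult_mono) auto
    moreover have "\<psi> v * laplace \<mu> v \<ge> 0" using 2 psi(1)[of v] v by simp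
    ultimately have "\<bar>R v\<bar> \<le> C" using 1 by (simp add: R_def C_def abs_le_iff)
    then have "(R v)\<^sup>2 \<le> C\<^sup>2" by (rule abs_le_square_iff[THEN iffD1, OF order_trans]) simp
    moreover have "(exp (- v))\<^sup>2 \<le> exp (- v)" using v by (simp add: power2_eq_square)
    ultimately show ?thesis unfolding G_def power_mult_distrib by (intro mult_mono) auto
  qed
  have "G u \<le> 0"
  proof (rule tendsto_lowerbound)
    have "((\<lambda>v. exp (- v)) \<longlongrightarrow> (0::real)) at_top"
      by (rule filterlim_compose[OF exp_at_bot filterlim_uminus_at_bot_at_top])
    then show "((\<lambda>v. C\<^sup>2 * exp (- v)) \<longlongrightarrow> 0) at_top" by (rule tendsto_mult_right_zero)
    show "\<forall>\<^sub>F v in at_top. G u \<le> C\<^sup>2 * exp (- v)"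
      using eventually_ge_at_top[of "max u 1"]
    proof eventually_elim
      case (elim v)
      then show ?case using mono[of v] bound[of v] by linarith
    qed
  qed simp
  then have "R u = 0" by (simp add: G_def)
  then show ?thesis using u by (simp add: R_def \<psi>_def field_simps)
qed

section \<open>Multiplicative convolution\<close>

lemma nn_integral_mult_conv:
  assumes "finite_measure M" "finite_measure N"
  assumes [measurable_cong]: "sets M = sets borel" "sets N = sets borel"
  assumes [measurable]: "f \<in> borel_measurable borel"
  shows "(\<integral>\<^sup>+x. f x \<partial>mult_conv M N) = (\<integral>\<^sup>+x. \<integral>\<^sup>+y. f (x * y) \<partial>N \<partial>M)"
proof -
  interpret M: finite_measure M by fact
  interpret N: finite_measure N by fact
  interpret pair_sigma_finite M N ..
  show ?thesis
    unfolding mult_conv_def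
    by (simp add: nn_integral_distr N.nn_integral_fst[symmetric])
qed

lemma prob_space_mult_conv:
  assumes "prob_space M" "prob_space N" and [measurable_cong]: "sets M = sets borel" "sets N = sets borel"
  shows "prob_space (mult_conv M N)"
proof -
  interpret M: prob_space M by fact
  interpret N: prob_space N by fact
  interpret pair_prob_space M N ..
  show ?thesis unfolding mult_conv_def by (intro prob_space_distr) measurable
qed

lemma nonneg_measure_mult_conv:
  assumes M: "prob_space M" "nonneg_measure M" and N: "prob_space N" "nonneg_measure N"
  shows "nonneg_measure (mult_conv M N)"
proof -
  note s[measurable_cong] = nonneg_measureD(2)[OF M(2)] nonneg_measureD(2)[OF N(2)]
  have "(\<integral>\<^sup>+x. indicator {..<0} x \<partial>mult_conv M N) = (\<integral>\<^sup>+x. \<integral>\<^sup>+y. indicator {..<0} (x * y) \<partial>N \<partial>M)"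
    by (rule nn_integral_mult_conv) (use nonneg_measureD[OF M(2)] nonneg_measureD[OF N(2)] in auto)
  also have "\<dots> = (\<integral>\<^sup>+x. \<integral>\<^sup>+y. 0 \<partial>N \<partial>M)"
    using nonneg_measureD(3)[OF M(2)]
  proof (intro nn_integral_cong_AE, eventually_elim)
    case (elim x)
    have "AE y in N. indicator {..<0} (x * y) = (0 :: ennreal)"
      using nonneg_measureD(3)[OF N(2)]
      by eventually_elim (use elim in \<open>simp add: not_less\<close>)
    then show ?case by (rule nn_integral_cong_AE)
  qed
  finally have "emeasure (mult_conv M N) {..<0} = 0" by (simp add: mult_conv_def)
  then have "AE x in mult_conv M N. 0 \<le> x"
    by (intro AE_I[of _ _ "{..<0}"]) (auto simp: not_le mult_conv_def)
  moreover have "prob_space (mult_conv M N)" using M N s by (intro prob_space_mult_conv)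
  moreover have "sets (mult_conv M N) = sets borel" by (simp add: mult_conv_def)
  ultimately show ?thesis by (simp add: nonneg_measure_def prob_space_def)
qed

section \<open>From the logarithmic derivative to selfdecomposability\<close>

lemma prob_space_log_uniform:
  assumes c: "0 < c" "c < (1::real)"
  shows "prob_space (density lborel (\<lambda>r. ennreal (inverse r / (- ln c)) * indicator {c..1} r))"
proof (rule prob_spaceI)
  have "(\<integral>\<^sup>+r. ennreal (inverse r / (- ln c)) * indicator {c..1} r \<partial>lborel) = ennreal (ln 1 / (- ln c) - ln c / (- ln c))"
  proof (rule nn_integral_FTC_Icc)
    have "- ln c > 0" using c by simp
    fix r assume "r \<in> {c..1}"
    then have "r > 0" using c by auto
    then show "((\<lambda>x. ln x / (- ln c)) has_real_derivative inverse r / (- ln c)) (at r)"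
      by (intro DERIV_cdivide DERIV_ln)
    show "0 \<le> inverse r / (- ln c)"
      using \<open>r > 0\<close> \<open>- ln c > 0\<close> by (intro divide_nonneg_pos) auto
  qed (use c in auto)
  then show "emeasure (density lborel (\<lambda>r. ennreal (inverse r / (- ln c)) * indicator {c..1} r))
      (space (density lborel (\<lambda>r. ennreal (inverse r / (- ln c)) * indicator {c..1} r))) = 1"
    using c by (simp add: emeasure_density)
qed

text \<open>Since \<open>ennreal\<close> truncates negative numbers to 0, positivity of one side
  suffices. It spares a separate sign argument for the logarithmic expression on the other
  side.\<close>

lemma ennreal_eq_imp_eq: "ennreal x = ennreal y \<Longrightarrow> 0 < x \<Longrightarrow> x = y"
  by (cases "0 \<le> y") (auto simp: ennreal_neg)

text \<open>Since \<open>\<phi>' / \<phi> = (M - a) / u\<close>, the exponent \<open>ln \<phi> u - ln \<phi> (c u)\<close> is the integral of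
  \<open>(M (u r) - a) / r\<close> over \<open>r \<in> {c..1}\<close>: the exponent of a compound Poisson law whose jumps are
  products of independent variables with laws \<open>N / a\<close> and \<open>dr / r\<close>.\<close>
lemma selfdecomposable_if_log_derivative:
  fixes a :: real
  assumes a: "a > 0" and pr: "prob_space \<mu>" and mu: "nonneg_measure \<mu>"
    and N: "nonneg_measure N" "measure N UNIV = a"
    and ld: "\<And>u. u > 0 \<Longrightarrow> u * laplace_moment 1 \<mu> u = (a - laplace N u) * laplace \<mu> u"
  shows "selfdecomposable \<mu>"
  unfolding selfdecomposable_def
proof (intro allI impI)
  fix c :: real
  assume c: "0 < c \<and> c < 1"
  \<comment> \<open>The product of the masses lost in normalising: \<open>a\<close> for
    \<open>N\<close>, and \<open>- ln c\<close> for \<open>dr / r\<close> on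
    \<open>{c..1}\<close>.\<close>
  define \<Lambda> where "\<Lambda> = - a * ln c"
  have lc: "- ln c > 0" using c by simp
  have \<Lambda>: "\<Lambda> > 0" using a c by (simp add: \<Lambda>_def mult_less_0_iff)
  define N' where "N' = scale_measure (ennreal (1 / a)) N"
  define L where "L = density lborel (\<lambda>r. ennreal (inverse r / (- ln c)) * indicator {c..1} r)"
  interpret N: finite_measure N using N(1) by (rule nonneg_measureD)
  note sN = nonneg_measureD(2)[OF N(1)]
  have spN: "space N = UNIV" using sN by (metis sets_eq_imp_space_eq space_borel)
  have spN': "space N' = UNIV"
    unfolding spN[symmetric] by (rule sets_eq_imp_space_eq) (simp add: N'_def)
  have N': "prob_space N'"
    by (rule prob_spaceI, unfold spN') (use a N(2) in \<open>simp add: N'_def N.emeasure_eq_measure flip: ennreal_mult\<close>)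
  have N'2: "nonneg_measure N'"
  proof -
    have "AE x in N'. 0 \<le> x"
      using nonneg_measureD(3)[OF N(1)] a
      by (auto simp: N'_def eventually_ae_filter null_sets_def spN spN'[unfolded N'_def])
    moreover have "sets N' = sets borel" by (simp add: N'_def sN)
    ultimately show ?thesis using N' by (simp add: nonneg_measure_def prob_space_def)
  qed
  have L: "prob_space L" unfolding L_def by (rule prob_space_log_uniform) (use c in auto)
  have L2: "nonneg_measure L"
  proof -
    have "AE x in L. 0 \<le> x"
      unfolding L_def using c by (subst AE_density) (auto split: split_indicator intro!: AE_I2)
    moreover have "sets L = sets borel" by (simp add: L_def)
    ultimately show ?thesis using L by (simp add: nonneg_measure_def prob_space_def)
  qed
  define Q where "Q = mult_conv L N'"
  have Q: "prob_space Q" "nonneg_measure Q"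
    unfolding Q_def using L L2 N' N'2
    by (auto intro!: prob_space_mult_conv nonneg_measure_mult_conv dest: nonneg_measureD)
  obtain \<nu> where nu: "prob_space \<nu>" "nonneg_measure \<nu>"
    "\<And>u. u \<ge> 0 \<Longrightarrow> laplace \<nu> u = exp (\<Lambda> * (laplace Q u - 1))"
    using compound_poisson[of \<Lambda> Q] Q \<Lambda> by auto
  have expo: "\<Lambda> * laplace Q u = ln (laplace \<mu> u) - ln (laplace \<mu> (u * c)) + \<Lambda>" if u: "u > 0" for u
  proof -
    have pos: "laplace \<mu> v > 0" if "v \<ge> 0" for v by (rule laplace_pos[OF pr mu that])
    have [measurable]: "laplace N \<in> borel_measurable borel" by (rule laplace_measurable[OF N(1)])
    have "ennreal (\<Lambda> * laplace Q u) = ennreal \<Lambda> * (\<integral>\<^sup>+x. ennreal (exp (- (u * x))) \<partial>Q)"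
      using \<Lambda> u by (simp add: nn_integral_laplace Q ennreal_mult laplace_moment_nonneg)
    also have "(\<integral>\<^sup>+x. ennreal (exp (- (u * x))) \<partial>Q) = (\<integral>\<^sup>+r. \<integral>\<^sup>+y. ennreal (exp (- (u * (r * y)))) \<partial>N' \<partial>L)"
      unfolding Q_def by (rule nn_integral_mult_conv) (use L2 N'2 in \<open>auto dest: nonneg_measureD\<close>)
    also have "\<dots> = (\<integral>\<^sup>+r. ennreal (1 / a) * (\<integral>\<^sup>+y. ennreal (exp (- (u * (r * y)))) \<partial>N) \<partial>L)"
      unfolding N'_def by (intro nn_integral_cong nn_integral_scale_measure) (simp add: measurable_cong_sets[OF sN refl])
    also have "\<dots> = (\<integral>\<^sup>+r. ennreal (1 / a) * ennreal (laplace N (u * r)) \<partial>L)"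
      using nonneg_measureD(3)[OF L2]
    proof (intro nn_integral_cong_AE, eventually_elim)
      case (elim r)
      then show ?case using nn_integral_laplace[OF N(1), of "u * r"] u by (simp add: mult.assoc)
    qed
    also have "\<dots> = (\<integral>\<^sup>+r. ennreal (inverse r / (- ln c)) * indicator {c..1} r * (ennreal (1 / a) * ennreal (laplace N (u * r))) \<partial>lborel)"
      unfolding L_def by (rule nn_integral_density) measurable
    also have "ennreal \<Lambda> * \<dots> = (\<integral>\<^sup>+r. ennreal \<Lambda> * (ennreal (inverse r / (- ln c)) * indicator {c..1} r * (ennreal (1 / a) * ennreal (laplace N (u * r)))) \<partial>lborel)"
      by (rule nn_integral_cmult[symmetric]) measurable
    also have "\<dots> = (\<integral>\<^sup>+r. ennreal (laplace N (u * r) / r) * indicator {c..1} r \<partial>lborel)"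
    proof (rule nn_integral_cong)
      fix r :: real
      show "ennreal \<Lambda> * (ennreal (inverse r / (- ln c)) * indicator {c..1} r * (ennreal (1 / a) * ennreal (laplace N (u * r))))
         = ennreal (laplace N (u * r) / r) * indicator {c..1} r"
      proof (cases "r \<in> {c..1}")
        case True
        then have r: "r > 0" using c by auto
        have "ennreal \<Lambda> * (ennreal (inverse r / (- ln c)) * (ennreal (1 / a) * ennreal (laplace N (u * r))))
           = ennreal (\<Lambda> * (inverse r / (- ln c) * (1 / a * laplace N (u * r))))"
        proof -
          have 1: "0 \<le> inverse r / (- ln c)" using r lc by (intro divide_nonneg_pos) auto
          have 2: "0 \<le> 1 / a * laplace N (u * r)" using a laplace_moment_nonneg[OF N(1)] by simp
          show ?thesis
            using a 1 2 \<Lambda> laplace_moment_nonneg[OF N(1), of 0 "u * r"] by (simp only: ennreal_mult less_imp_le divide_nonneg_nonneg zero_le_one mult_nonneg_nonneg)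
        qed
        also have "\<Lambda> * (inverse r / (- ln c) * (1 / a * laplace N (u * r))) = laplace N (u * r) / r"
          using a lc r by (simp add: \<Lambda>_def field_simps)
        finally show ?thesis using True by simp
      qed simp
    qed
    \<comment> \<open>The term \<open>a * ln r\<close> in the antiderivative compensates the
      \<open>- a / r\<close> contained in the logarithmic derivative, leaving the nonnegative
      integrand.\<close>
    also have "\<dots> = ennreal ((ln (laplace \<mu> (u * 1)) + a * ln 1) - (ln (laplace \<mu> (u * c)) + a * ln c))"
    proof (rule nn_integral_FTC_Icc)
      fix r assume r: "r \<in> {c..1}"
      then have "r > 0" using c by auto
      then have ur: "u * r > 0" using u by simp
      have d: "((\<lambda>r. laplace \<mu> (u * r)) has_real_derivative - laplace_moment 1 \<mu> (u * r) * u) (at r)"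
        using has_derivative_laplace_moment[OF mu ur, of 0]
        by (intro DERIV_chain2[where f = "laplace \<mu>" and g = "\<lambda>r. u * r"])
           (auto intro!: derivative_eq_intros)
      have "((\<lambda>r. ln (laplace \<mu> (u * r)) + a * ln r) has_real_derivative
          1 / laplace \<mu> (u * r) * (- laplace_moment 1 \<mu> (u * r) * u) + a * (1 / r)) (at r)"
        using pos[of "u * r"] ur \<open>r > 0\<close> d
        by (auto intro!: derivative_eq_intros)
      also have "laplace_moment 1 \<mu> (u * r) = (a - laplace N (u * r)) * laplace \<mu> (u * r) / (u * r)"
        unfolding ld[OF ur, symmetric] using u \<open>r > 0\<close> by simp
      also have "1 / laplace \<mu> (u * r) * (- ((a - laplace N (u * r)) * laplace \<mu> (u * r) / (u * r)) * u) + a * (1 / r) = laplace N (u * r) / r"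
        using pos[of "u * r"] ur \<open>r > 0\<close> u by (simp add: field_simps)
      finally show "((\<lambda>r. ln (laplace \<mu> (u * r)) + a * ln r) has_real_derivative laplace N (u * r) / r) (at r)" .
      show "0 \<le> laplace N (u * r) / r"
        using \<open>r > 0\<close> laplace_moment_nonneg[OF N(1)] by simp
    qed (use c in auto)
    finally have "ennreal (\<Lambda> * laplace Q u) = ennreal (ln (laplace \<mu> u) - ln (laplace \<mu> (u * c)) + \<Lambda>)"
      by (simp add: \<Lambda>_def algebra_simps)
    moreover have "\<Lambda> * laplace Q u > 0" using \<Lambda> laplace_pos[OF Q, of u] u by simp
    ultimately show ?thesis by (rule ennreal_eq_imp_eq)
  qed
  have sm[measurable_cong]: "sets \<mu> = sets borel" using mu by (rule nonneg_measureD)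
  have D: "prob_space (dilate c \<mu>)"
    unfolding dilate_def by (rule prob_space.prob_space_distr[OF pr]) measurable
  have D2: "nonneg_measure (dilate c \<mu>)"
  proof -
    have "AE x in dilate c \<mu>. 0 \<le> x"
      using nonneg_measureD(3)[OF mu] c unfolding dilate_def by (subst AE_distr_iff) auto
    moreover have "sets (dilate c \<mu>) = sets borel" by (simp add: dilate_def)
    ultimately show ?thesis using D by (simp add: nonneg_measure_def prob_space_def)
  qed
  have lD: "laplace (dilate c \<mu>) u = laplace \<mu> (u * c)" for u
    unfolding laplace_moment_def dilate_def by (subst integral_distr) (auto simp: mult.assoc)
  have "\<mu> = convolution (dilate c \<mu>) \<nu>"
  proof (rule laplace_unique)
    show "prob_space (convolution (dilate c \<mu>) \<nu>)"
      using D nu D2 by (intro prob_space_convolution) (auto dest: nonneg_measureD)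
    show "nonneg_measure (convolution (dilate c \<mu>) \<nu>)"
      using nu D2 by (intro nonneg_measure_convolution)
    show "laplace \<mu> u = laplace (convolution (dilate c \<mu>) \<nu>) u" if u: "u > 0" for u
    proof -
      have p: "laplace \<mu> u > 0" "laplace \<mu> (u * c) > 0"
        using laplace_pos[OF pr mu] u c by auto
      have "laplace (convolution (dilate c \<mu>) \<nu>) u = laplace \<mu> (u * c) * exp (\<Lambda> * laplace Q u - \<Lambda>)"
        using u nu D2 by (simp add: laplace_convolution lD algebra_simps)
      also have "\<dots> = laplace \<mu> u"
        using p by (simp add: expo[OF u] exp_diff)
      finally show ?thesis ..
    qed
  qed (fact pr mu)+
  then show "\<exists>\<nu>. prob_space \<nu> \<and> sets \<nu> = sets borel \<and> \<mu> = convolution (dilate c \<mu>) \<nu>"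
    using nu by (auto dest: nonneg_measureD)
qed

lemma selfdecomposable_beta_prime:
  assumes "a > 0" "b \<ge> 1" "prob_space (beta_prime a b)"
  shows "selfdecomposable (beta_prime a b)"
proof -
  note M = nonneg_measure_beta_prime[OF assms(3)]
  obtain N where N: "nonneg_measure N" "measure N UNIV = a"
    "\<And>u. u > 0 \<Longrightarrow> u * laplace_moment 1 N u = (laplace N u - a) * (laplace N u - a - b) - u * laplace N u"
    using riccati_measure[of a b] assms by auto
  show ?thesis
    by (rule selfdecomposable_if_log_derivative[OF assms(1,3) M N(1,2)])
       (rule log_derivative_laplace[OF assms M N(1,2) beta_prime_kummer[OF assms] N(3)])
qed

text \<open>Dilations commute with one another and distribute over convolution, so the cofactor for
  \<open>dilate s \<mu>\<close> is \<open>dilate s \<nu>\<close>.\<close>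

lemma selfdecomposable_dilate:
  assumes sd: "selfdecomposable \<mu>" and pr: "prob_space \<mu>" and [measurable_cong]: "sets \<mu> = sets borel"
  shows "selfdecomposable (dilate s \<mu>)"
  unfolding selfdecomposable_def
proof (intro allI impI)
  fix c :: real
  assume "0 < c \<and> c < 1"
  then obtain \<nu> where nu: "prob_space \<nu>" "sets \<nu> = sets borel" and eq: "\<mu> = convolution (dilate c \<mu>) \<nu>"
    using sd unfolding selfdecomposable_def by blast
  note [measurable_cong] = nu(2)
  interpret mu: prob_space \<mu> by fact
  interpret nu: prob_space \<nu> by fact
  have p: "prob_space (dilate r \<mu>)" "prob_space (dilate r \<nu>)" for r
    unfolding dilate_def by (intro mu.prob_space_distr nu.prob_space_distr; measurable)+
  have sets: "sets (dilate r \<mu>) = sets borel" "sets (dilate r \<nu>) = sets borel" for r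
    by (simp_all add: dilate_def)
  note [measurable_cong] = sets
  interpret D: prob_space "dilate c \<mu>" by (rule p)
  interpret P: pair_prob_space "dilate c \<mu>" \<nu> ..
  have "dilate s \<mu> = dilate s (convolution (dilate c \<mu>) \<nu>)" using eq by simp
  also have "\<dots> = distr (dilate c \<mu> \<Otimes>\<^sub>M \<nu>) borel (\<lambda>(x, y). s * x + s * y)"
    unfolding convolution_def by (simp add: dilate_def[of s] distr_distr o_def case_prod_unfold distrib_left)
  also have "\<dots> = convolution (dilate s (dilate c \<mu>)) (dilate s \<nu>)"
    unfolding convolution_def dilate_def[of s]
    by (subst pair_measure_distr)
       (auto intro!: prob_space_imp_sigma_finite nu.prob_space_distr simp: distr_distr o_def case_prod_unfold)
  also have "dilate s (dilate c \<mu>) = dilate c (dilate s \<mu>)"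
    by (simp add: dilate_def distr_distr o_def mult_ac)
  finally show "\<exists>\<nu>. prob_space \<nu> \<and> sets \<nu> = sets borel \<and> dilate s \<mu> = convolution (dilate c (dilate s \<mu>)) \<nu>"
    using p(2)[of s] sets(2)[of s] by blast
qed

section \<open>Densities under dilation and inversion, and quotients of gamma laws\<close>

lemma dilate_density:
  assumes c: "c > 0" and [measurable]: "f \<in> borel_measurable borel"
  shows "dilate c (density lborel f) = density lborel (\<lambda>x. f (x / c) * ennreal (1 / c))"
proof (rule measure_eqI)
  fix A assume "A \<in> sets (dilate c (density lborel f))"
  then have [measurable]: "A \<in> sets borel" by (simp add: dilate_def)
  have "emeasure (density lborel (\<lambda>x. f (x / c) * ennreal (1 / c))) A
      = (\<integral>\<^sup>+x. f (x / c) * ennreal (1 / c) * indicator A x \<partial>lborel)"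
    by (rule emeasure_density) auto
  also have "\<dots> = ennreal \<bar>c\<bar> * (\<integral>\<^sup>+x. f ((0 + c * x) / c) * ennreal (1 / c) * indicator A (0 + c * x) \<partial>lborel)"
    by (rule nn_integral_real_affine) (use c in auto)
  also have "\<dots> = (\<integral>\<^sup>+x. ennreal c * (f x * ennreal (1 / c) * indicator A (c * x)) \<partial>lborel)"
    using c by (subst nn_integral_cmult) auto
  also have "\<dots> = (\<integral>\<^sup>+x. f x * indicator A (c * x) \<partial>lborel)"
  proof (rule nn_integral_cong)
    fix x
    have "ennreal c * ennreal (1 / c) = 1" using c by (simp flip: ennreal_mult)
    moreover have "ennreal c * (f x * ennreal (1 / c) * indicator A (c * x)) =
        ennreal c * ennreal (1 / c) * (f x * indicator A (c * x))"
      by (simp only: mult_ac)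
    ultimately show "ennreal c * (f x * ennreal (1 / c) * indicator A (c * x)) = f x * indicator A (c * x)"
      by simp
  qed
  also have "\<dots> = (\<integral>\<^sup>+x. indicator A (c * x) \<partial>density lborel f)"
    by (simp add: nn_integral_density)
  also have "\<dots> = (\<integral>\<^sup>+x. indicator A x \<partial>dilate c (density lborel f))"
    unfolding dilate_def by (subst nn_integral_distr) auto
  also have "\<dots> = emeasure (dilate c (density lborel f)) A"
    by (simp add: dilate_def)
  finally show "emeasure (dilate c (density lborel f)) A = emeasure (density lborel (\<lambda>x. f (x / c) * ennreal (1 / c))) A" ..
qed (simp add: dilate_def)

lemma Gamma_nn_integral_scaled:
  fixes p s :: real
  assumes "p > 0" "s > 0"
  shows "(\<integral>\<^sup>+y. ennreal (indicator {0<..} y * y powr (p - 1) * exp (- (s * y))) \<partial>lborel)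
    = ennreal (Gamma p / s powr p)"
proof -
  have "ennreal (Gamma p) = (\<integral>\<^sup>+t. ennreal (indicator {0..} t * t powr (p - 1) / exp t) \<partial>lborel)"
    by (rule Gamma_conv_nn_integral_real[OF \<open>p > 0\<close>])
  also have "\<dots> = ennreal \<bar>s\<bar> * (\<integral>\<^sup>+y. ennreal (indicator {0..} (0 + s * y) * (0 + s * y) powr (p - 1) / exp (0 + s * y)) \<partial>lborel)"
    by (rule nn_integral_real_affine) (use assms in auto)
  also have "(\<integral>\<^sup>+y. ennreal (indicator {0..} (0 + s * y) * (0 + s * y) powr (p - 1) / exp (0 + s * y)) \<partial>lborel)
    = (\<integral>\<^sup>+y. ennreal (s powr (p - 1)) * ennreal (indicator {0<..} y * y powr (p - 1) * exp (- (s * y))) \<partial>lborel)"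
    using assms by (intro nn_integral_cong)
      (auto simp: powr_mult exp_minus field_simps zero_le_mult_iff split: split_indicator simp flip: ennreal_mult)
  also have "\<dots> = ennreal (s powr (p - 1)) * (\<integral>\<^sup>+y. ennreal (indicator {0<..} y * y powr (p - 1) * exp (- (s * y))) \<partial>lborel)" (is "_ = _ * ?I")
    by (rule nn_integral_cmult) measurable
  finally have "ennreal (1 / s powr p) * ennreal (Gamma p) = ennreal (1 / s powr p) * (ennreal s * (ennreal (s powr (p - 1)) * ?I))"
    using assms by simp
  also have "\<dots> = ennreal (1 / s powr p * (s * s powr (p - 1))) * ?I"
    unfolding mult.assoc[symmetric] using assms by (simp flip: ennreal_mult)
  also have "1 / s powr p * (s * s powr (p - 1)) = 1"
    using assms by (simp add: powr_diff)
  finally show ?thesis using assms by (simp flip: ennreal_mult)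
qed

text \<open>The substitution rests on the change of variables theorem for absolutely integrable
  functions, hence the integrability assumption and the detour through \<open>integral\<close>;
  \<open>conv\<close> in the proof translates back.\<close>

lemma nn_integral_inverse_subst:
  fixes f :: "real \<Rightarrow> real"
  assumes [measurable]: "f \<in> borel_measurable borel" and nn: "\<And>x. f x \<ge> 0"
    and i: "set_integrable lborel {0<..} f"
  shows "(\<integral>\<^sup>+x. ennreal (indicator {0<..} x * (f (inverse x) / x\<^sup>2)) \<partial>lborel) = (\<integral>\<^sup>+x. ennreal (indicator {0<..} x * f x) \<partial>lborel)"
proof -
  let ?S = "{0 :: real <..}"
  define b where "b = integral ?S f"
  define h where "h x = f (inverse x) / x\<^sup>2" for x
  have [measurable]: "h \<in> borel_measurable borel" unfolding h_def by measurable
  have hn: "h x \<ge> 0" for x using nn by (simp add: h_def)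
  have img: "inverse ` ?S = ?S"
    by (auto simp: image_iff intro!: bexI[of _ "inverse _"])
  have f: "f absolutely_integrable_on ?S"
    using i unfolding set_integrable_def by (intro integrable_completion[THEN iffD2]) auto
  have "(\<lambda>x. \<bar>- inverse (x\<^sup>2)\<bar> * f (inverse x)) absolutely_integrable_on ?S \<and>
      integral ?S (\<lambda>x. \<bar>- inverse (x\<^sup>2)\<bar> * f (inverse x)) = b"
  proof (rule has_absolute_integral_change_of_variables_1'[where S = ?S and g = inverse
        and g' = "\<lambda>x. - inverse (x\<^sup>2)", THEN iffD2])
    show "(inverse has_real_derivative - inverse (x\<^sup>2)) (at x within ?S)" if "x \<in> ?S" for x
      using that by (auto intro!: derivative_eq_intros simp: power2_eq_square)
  qed (use f in \<open>auto simp: img b_def inj_on_def\<close>)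
  moreover have "(\<lambda>x. \<bar>- inverse (x\<^sup>2)\<bar> * f (inverse x)) = h"
    by (auto simp: h_def field_simps)
  ultimately have h: "h absolutely_integrable_on ?S" and hb: "integral ?S h = b" by simp_all
  have conv: "(\<integral>\<^sup>+x. ennreal (indicator ?S x * g x) \<partial>lborel) = ennreal (integral ?S g)"
    if g: "g absolutely_integrable_on ?S" and [measurable]: "g \<in> borel_measurable borel" and "\<And>x. g x \<ge> 0" for g :: "real \<Rightarrow> real"
  proof -
    have "set_integrable lborel ?S g"
      using g unfolding set_integrable_def by (subst (asm) integrable_completion) auto
    then have "(\<integral>\<^sup>+x. ennreal (indicator ?S x * g x) \<partial>lborel) = ennreal (set_lebesgue_integral lborel ?S g)"
      unfolding set_integrable_def set_lebesgue_integral_def using that(3)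
      by (subst nn_integral_eq_integral) auto
    also have "set_lebesgue_integral lborel ?S g = integral ?S g"
      by (rule set_borel_integral_eq_integral) fact
    finally show ?thesis .
  qed
  show ?thesis using conv[OF h] conv[OF f] hn nn hb by (simp add: b_def h_def)
qed

lemma sets_gamma_dist [simp, measurable_cong]: "sets (gamma_dist a b) = sets borel"
  by (simp add: gamma_dist_def)

lemma prob_space_gamma_dist:
  assumes "a > 0"
  shows "prob_space (gamma_dist a 1)"
proof (rule prob_spaceI)
  have "Gamma a > 0" using assms by simp
  have "emeasure (gamma_dist a 1) (space (gamma_dist a 1)) =
     (\<integral>\<^sup>+x. ennreal (1 / Gamma a) * ennreal (indicator {0<..} x * x powr (a - 1) * exp (- (1 * x))) \<partial>lborel)"
    unfolding gamma_dist_def using \<open>Gamma a > 0\<close>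
    by (subst emeasure_density) (auto intro!: nn_integral_cong simp flip: ennreal_mult)
  also have "\<dots> = ennreal (1 / Gamma a) * ennreal (Gamma a / 1 powr a)"
    by (subst nn_integral_cmult) (auto simp only: Gamma_nn_integral_scaled[OF assms zero_less_one], measurable)
  also have "\<dots> = 1" using \<open>Gamma a > 0\<close> by (simp flip: ennreal_mult)
  finally show "emeasure (gamma_dist a 1) (space (gamma_dist a 1)) = 1" .
qed

lemma gamma_dist_dilate:
  assumes "a > 0" "c > 0"
  shows "gamma_dist a c = dilate c (gamma_dist a 1)"
proof -
  have "Gamma a > 0" using assms by simp
  show ?thesis
    unfolding gamma_dist_def
  proof (subst dilate_density[OF \<open>c > 0\<close>], measurable, rule density_cong)
    show "AE x in lborel. ennreal (indicator {0<..} x * x powr (a - 1) * exp (- x / c) / (c powr a * Gamma a)) =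
      ennreal (indicator {0<..} (x / c) * (x / c) powr (a - 1) * exp (- (x / c) / 1) / (1 powr a * Gamma a)) * ennreal (1 / c)"
    proof (rule AE_I2)
      fix x :: real
      have "c powr a = c powr (a - 1) * c" using assms by (simp add: powr_diff)
      then show "ennreal (indicator {0<..} x * x powr (a - 1) * exp (- x / c) / (c powr a * Gamma a)) =
        ennreal (indicator {0<..} (x / c) * (x / c) powr (a - 1) * exp (- (x / c) / 1) / (1 powr a * Gamma a)) * ennreal (1 / c)"
        using assms \<open>Gamma a > 0\<close>
        by (auto simp: powr_divide zero_less_divide_iff split: split_indicator simp flip: ennreal_mult)
    qed
  qed measurable
qed

lemma prob_space_meas_inv:
  assumes "prob_space \<mu>" and [measurable_cong]: "sets \<mu> = sets borel"
  shows "prob_space (meas_inv \<mu>)"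
  unfolding meas_inv_def by (rule prob_space.prob_space_distr[OF assms(1)]) measurable

lemma meas_inv_gamma_dist:
  assumes b: "b > 0"
  shows "meas_inv (gamma_dist b 1) =
    density lborel (\<lambda>x. ennreal (indicator {0<..} x * x powr (- b - 1) * exp (- 1 / x) / Gamma b))"
proof (rule measure_eqI)
  interpret prob_space "gamma_dist b 1" by (rule prob_space_gamma_dist[OF b])
  have G: "Gamma b > 0" using b by simp
  fix A assume "A \<in> sets (meas_inv (gamma_dist b 1))"
  then have A[measurable]: "A \<in> sets borel" by (simp add: meas_inv_def)
  define g where "g x = indicator {0<..} x * x powr (b - 1) * exp (- x / 1) / (1 powr b * Gamma b)" for x :: real
  have [measurable]: "g \<in> borel_measurable borel" unfolding g_def by measurable
  have gn: "g x \<ge> 0" for x using G by (simp add: g_def)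
  have gd: "gamma_dist b 1 = density lborel (\<lambda>x. ennreal (g x))" by (simp add: gamma_dist_def g_def)
  have "(\<integral>\<^sup>+x. ennreal (g x) \<partial>lborel) = 1"
    using emeasure_space_1 unfolding gd by (simp add: emeasure_density)
  then have gi: "integrable lborel g"
    using gn by (intro integrableI_nonneg) auto
  \<comment> \<open>The preimage of \<open>A\<close> is absorbed into the integrand, so that the
    substitution gives the measure of \<open>A\<close>; domination by \<open>g\<close> makes it
    applicable.\<close>
  define f where "f x = g x * indicator A (inverse x)" for x
  have [measurable]: "f \<in> borel_measurable borel" unfolding f_def by measurable
  have "set_integrable lborel {0<..} f"
    unfolding set_integrable_def
    by (rule Bochner_Integration.integrable_bound[OF gi])
       (auto simp: f_def gn split: split_indicator)
  note sub = nn_integral_inverse_subst[OF _ _ this]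
  have "emeasure (meas_inv (gamma_dist b 1)) A = (\<integral>\<^sup>+x. indicator A x \<partial>meas_inv (gamma_dist b 1))"
    by (simp add: meas_inv_def)
  also have "\<dots> = (\<integral>\<^sup>+x. ennreal (g x) * indicator A (inverse x) \<partial>lborel)"
    unfolding meas_inv_def gd by (subst nn_integral_distr) (auto simp: nn_integral_density)
  also have "\<dots> = (\<integral>\<^sup>+x. ennreal (indicator {0<..} x * f x) \<partial>lborel)"
    by (intro nn_integral_cong) (auto simp: f_def g_def split: split_indicator)
  also have "\<dots> = (\<integral>\<^sup>+x. ennreal (indicator {0<..} x * (f (inverse x) / x\<^sup>2)) \<partial>lborel)"
    by (rule sub[symmetric]) (auto simp: f_def gn)
  also have "\<dots> = (\<integral>\<^sup>+x. ennreal (indicator {0<..} x * x powr (- b - 1) * exp (- 1 / x) / Gamma b) * indicator A x \<partial>lborel)"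
  proof (rule nn_integral_cong)
    fix x :: real
    have "inverse x powr (b - 1) / x\<^sup>2 = x powr (- b - 1)" if "x > 0"
    proof -
      have "x\<^sup>2 = x powr 2" using that by simp
      moreover have "inverse x powr (b - 1) = x powr (- (b - 1))"
        using that by (simp only: powr_minus inverse_powr less_imp_le)
      ultimately show ?thesis using that by (simp only: flip: powr_diff) (rule arg_cong[where f = "(powr) x"], simp)
    qed
    then show "ennreal (indicator {0<..} x * (f (inverse x) / x\<^sup>2)) = ennreal (indicator {0<..} x * x powr (- b - 1) * exp (- 1 / x) / Gamma b) * indicator A x"
      by (auto simp: f_def g_def field_simps split: split_indicator)
  qed
  also have "\<dots> = emeasure (density lborel (\<lambda>x. ennreal (indicator {0<..} x * x powr (- b - 1) * exp (- 1 / x) / Gamma b))) A"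
    by (rule emeasure_density[symmetric]) auto
  finally show "emeasure (meas_inv (gamma_dist b 1)) A = \<dots>" .
qed (simp add: meas_inv_def)

lemma gamma_ratio_beta_prime:
  assumes a: "a > 0" and b: "b > 0"
  shows "mult_conv (gamma_dist a 1) (meas_inv (gamma_dist b 1)) = beta_prime a b"
proof (rule measure_eqI)
  interpret Ga: prob_space "gamma_dist a 1" by (rule prob_space_gamma_dist[OF a])
  interpret Gb: prob_space "gamma_dist b 1" by (rule prob_space_gamma_dist[OF b])
  have G: "Gamma a > 0" "Gamma b > 0" "Gamma (a + b) > 0" using a b by simp_all
  fix A assume "A \<in> sets (mult_conv (gamma_dist a 1) (meas_inv (gamma_dist b 1)))"
  then have A[measurable]: "A \<in> sets borel" by (simp add: mult_conv_def)
  define g where "g p x = indicator {0<..} x * x powr (p - 1) * exp (- x / 1) / (1 powr p * Gamma p)" for p x :: real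
  have [measurable]: "g p \<in> borel_measurable borel" for p unfolding g_def by measurable
  have gn: "g a x \<ge> 0" "g b x \<ge> 0" for x using G by (auto simp: g_def)
  have gd: "gamma_dist p 1 = density lborel (\<lambda>x. ennreal (g p x))" for p by (simp add: gamma_dist_def g_def)
  let ?I = "indicator A :: real \<Rightarrow> ennreal"
  have "emeasure (mult_conv (gamma_dist a 1) (meas_inv (gamma_dist b 1))) A
      = (\<integral>\<^sup>+x. ?I x \<partial>mult_conv (gamma_dist a 1) (meas_inv (gamma_dist b 1)))"
    by (simp add: mult_conv_def)
  also have "\<dots> = (\<integral>\<^sup>+x. \<integral>\<^sup>+y. ?I (x * y) \<partial>meas_inv (gamma_dist b 1) \<partial>gamma_dist a 1)"
    using prob_space_meas_inv[OF Gb.prob_space_axioms]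
    by (intro nn_integral_mult_conv) (auto simp: prob_space_def meas_inv_def Ga.finite_measure_axioms)
  also have "\<dots> = (\<integral>\<^sup>+x. \<integral>\<^sup>+y. ?I (x * inverse y) \<partial>gamma_dist b 1 \<partial>gamma_dist a 1)"
    unfolding meas_inv_def by (simp add: nn_integral_distr)
  also have "\<dots> = (\<integral>\<^sup>+x. ennreal (g a x) * (\<integral>\<^sup>+y. ennreal (g b y) * ?I (x * inverse y) \<partial>lborel) \<partial>lborel)"
    unfolding gd by (simp add: nn_integral_density)
  also have "\<dots> = (\<integral>\<^sup>+x. \<integral>\<^sup>+y. ennreal (g a x) * (ennreal (g b y) * ?I (x * inverse y)) \<partial>lborel \<partial>lborel)"
    by (simp add: nn_integral_cmult)
  also have "\<dots> = (\<integral>\<^sup>+y. \<integral>\<^sup>+x. ennreal (g a x) * (ennreal (g b y) * ?I (x * inverse y)) \<partial>lborel \<partial>lborel)"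
    by (rule lborel_pair.Fubini') measurable
  \<comment> \<open>For fixed positive \<open>y\<close> put \<open>x = z * y\<close>; the Jacobian
    is the factor \<open>y\<close>, and the test set no longer depends on \<open>y\<close>.\<close>
  also have "\<dots> = (\<integral>\<^sup>+y. \<integral>\<^sup>+z. ennreal (y * g a (z * y) * g b y) * ?I z \<partial>lborel \<partial>lborel)"
  proof (rule nn_integral_cong)
    fix y :: real
    show "(\<integral>\<^sup>+x. ennreal (g a x) * (ennreal (g b y) * ?I (x * inverse y)) \<partial>lborel)
       = (\<integral>\<^sup>+z. ennreal (y * g a (z * y) * g b y) * ?I z \<partial>lborel)"
    proof (cases "y > 0")
      case True
      have "(\<integral>\<^sup>+x. ennreal (g a x) * (ennreal (g b y) * ?I (x * inverse y)) \<partial>lborel)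
        = ennreal \<bar>y\<bar> * (\<integral>\<^sup>+z. ennreal (g a (0 + y * z)) * (ennreal (g b y) * ?I ((0 + y * z) * inverse y)) \<partial>lborel)"
        by (rule nn_integral_real_affine) (use True in auto)
      also have "\<dots> = (\<integral>\<^sup>+z. ennreal \<bar>y\<bar> * (ennreal (g a (0 + y * z)) * (ennreal (g b y) * ?I ((0 + y * z) * inverse y))) \<partial>lborel)"
        by (rule nn_integral_cmult[symmetric]) measurable
      also have "\<dots> = (\<integral>\<^sup>+z. ennreal (y * g a (z * y) * g b y) * ?I z \<partial>lborel)"
        using True gn by (intro nn_integral_cong) (simp add: ennreal_mult mult_ac)
      finally show ?thesis .
    qed (simp add: g_def)
  qed
  also have "\<dots> = (\<integral>\<^sup>+z. \<integral>\<^sup>+y. ennreal (y * g a (z * y) * g b y) * ?I z \<partial>lborel \<partial>lborel)"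
    by (rule lborel_pair.Fubini') measurable
  also have "\<dots> = (\<integral>\<^sup>+z. ennreal (beta_prime_weight a b z / Beta a b) * ?I z \<partial>lborel)"
  proof (rule nn_integral_cong)
    fix z :: real
    have "(\<integral>\<^sup>+y. ennreal (y * g a (z * y) * g b y) \<partial>lborel) = ennreal (beta_prime_weight a b z / Beta a b)"
    proof (cases "z > 0")
      case True
      define C where "C = z powr (a - 1) / (Gamma a * Gamma b)"
      have C: "C \<ge> 0" using G by (simp add: C_def)
      \<comment> \<open>As a function of \<open>y\<close> the integrand is a gamma density up to
        constants, with shape \<open>a + b\<close> and rate \<open>1 + z\<close>; its integral
        yields the power of \<open>1 + z\<close> and completes the Beta constant.\<close>
      have "(\<integral>\<^sup>+y. ennreal (y * g a (z * y) * g b y) \<partial>lborel)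
        = (\<integral>\<^sup>+y. ennreal C * ennreal (indicator {0<..} y * y powr ((a + b) - 1) * exp (- ((1 + z) * y))) \<partial>lborel)"
      proof (rule nn_integral_cong)
        fix y :: real
        show "ennreal (y * g a (z * y) * g b y) = ennreal C * ennreal (indicator {0<..} y * y powr ((a + b) - 1) * exp (- ((1 + z) * y)))"
        proof (cases "y > 0")
          case y: True
          have e1: "y powr (a + b - 1) = y * (y powr (a - 1) * y powr (b - 1))"
            using y by (simp add: powr_diff powr_add)
          have e2: "exp (- ((1 + z) * y)) = exp (- (z * y)) * exp (- y)"
            by (simp add: algebra_simps flip: exp_add)
          have "y * g a (z * y) * g b y = C * (y powr ((a + b) - 1) * exp (- ((1 + z) * y)))"
            unfolding e1 e2 using y True by (simp add: g_def C_def powr_mult)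
          then show ?thesis using y C by (simp add: ennreal_mult)
        qed (simp add: g_def)
      qed
      also have "\<dots> = ennreal C * (\<integral>\<^sup>+y. ennreal (indicator {0<..} y * y powr ((a + b) - 1) * exp (- ((1 + z) * y))) \<partial>lborel)"
        by (rule nn_integral_cmult) measurable
      also have "\<dots> = ennreal C * ennreal (Gamma (a + b) / (1 + z) powr (a + b))"
        using a b True by (subst Gamma_nn_integral_scaled) auto
      also have "\<dots> = ennreal (beta_prime_weight a b z / Beta a b)"
        using True C G unfolding C_def Beta_def beta_prime_weight_def powr_minus_divide
        by (simp add: field_simps flip: ennreal_mult)
      finally show ?thesis .
    next
      case False
      have z: "y * g a (z * y) * g b y = 0" for y
        using False by (auto simp: g_def zero_less_mult_iff split: split_indicator)
      show ?thesis unfolding z using False by (simp add: beta_prime_weight_def)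
    qed
    then show "(\<integral>\<^sup>+y. ennreal (y * g a (z * y) * g b y) * ?I z \<partial>lborel) = ennreal (beta_prime_weight a b z / Beta a b) * ?I z"
      by (subst nn_integral_multc) auto
  qed
  also have "\<dots> = emeasure (beta_prime a b) A"
    unfolding beta_prime_def by (rule emeasure_density[symmetric]) auto
  finally show "emeasure (mult_conv (gamma_dist a 1) (meas_inv (gamma_dist b 1))) A = emeasure (beta_prime a b) A" .
qed (simp add: mult_conv_def beta_prime_def)

text \<open>The total mass is read off from the product law, so the Beta integral is never
  evaluated.\<close>

lemma prob_space_beta_prime:
  assumes "a > 0" "b > 0"
  shows "prob_space (beta_prime a b)"
  unfolding gamma_ratio_beta_prime[OF assms, symmetric]
  using assms by (intro prob_space_mult_conv prob_space_meas_inv prob_space_gamma_dist) (auto simp: meas_inv_def)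

section \<open>Rules for multiplicative convolution and the Gibbs measures\<close>

lemma mult_conv_commute:
  assumes "prob_space M" "prob_space N" and [measurable_cong]: "sets M = sets borel" "sets N = sets borel"
  shows "mult_conv M N = mult_conv N M"
proof -
  interpret M: prob_space M by fact
  interpret N: prob_space N by fact
  interpret pair_sigma_finite M N ..
  show ?thesis
    unfolding mult_conv_def
    by (subst distr_pair_swap) (simp add: distr_distr o_def case_prod_unfold mult.commute)
qed

lemma mult_conv_dilate:
  assumes "prob_space M" "prob_space N" and [measurable_cong]: "sets M = sets borel" "sets N = sets borel"
  shows "mult_conv (dilate r M) (dilate s N) = dilate (r * s) (mult_conv M N)"
proof -
  interpret M: prob_space M by fact
  interpret N: prob_space N by fact
  have "mult_conv (dilate r M) (dilate s N) = distr (M \<Otimes>\<^sub>M N) borel (\<lambda>(x, y). (r * x) * (s * y))"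
    unfolding mult_conv_def dilate_def
    by (subst pair_measure_distr)
       (auto intro!: prob_space_imp_sigma_finite N.prob_space_distr simp: distr_distr o_def case_prod_unfold)
  also have "\<dots> = dilate (r * s) (mult_conv M N)"
    unfolding mult_conv_def dilate_def by (simp add: distr_distr o_def case_prod_unfold mult_ac)
  finally show ?thesis .
qed

text \<open>A probability density determines its own constant: \<open>C\<close> has to be the
  reciprocal of \<open>Z_norm\<close>. The partition function is thus never computed from the
  potential.\<close>

lemma rho_eq_density:
  assumes C: "C > 0"
    and pr: "prob_space (density lborel (\<lambda>x. ennreal (C * (indicator {0<..} x * exp (- V_pot t \<theta> l x)))))"
  shows "rho t \<theta> l = density lborel (\<lambda>x. ennreal (C * (indicator {0<..} x * exp (- V_pot t \<theta> l x))))"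
proof -
  define g where "g x = indicator {0<..} x * exp (- V_pot t \<theta> l x)" for x
  have [measurable]: "V_pot t \<theta> l \<in> borel_measurable borel"
    unfolding V_pot_def by measurable
  have [measurable]: "g \<in> borel_measurable borel" unfolding g_def by measurable
  have gn: "g x \<ge> 0" for x by (simp add: g_def)
  have "1 = (\<integral>\<^sup>+x. ennreal (C * g x) \<partial>lborel)"
    using prob_space.emeasure_space_1[OF pr] unfolding g_def[symmetric] by (simp add: emeasure_density)
  also have "\<dots> = ennreal C * (\<integral>\<^sup>+x. ennreal (g x) \<partial>lborel)"
    using C gn by (simp add: ennreal_mult nn_integral_cmult)
  finally have eq: "ennreal C * (\<integral>\<^sup>+x. ennreal (g x) \<partial>lborel) = 1" ..
  have "(\<integral>\<^sup>+x. ennreal (g x) \<partial>lborel) = ennreal (1 / C) * (ennreal C * (\<integral>\<^sup>+x. ennreal (g x) \<partial>lborel))"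
    using C by (simp flip: mult.assoc ennreal_mult)
  then have "(\<integral>\<^sup>+x. ennreal (g x) \<partial>lborel) = ennreal (1 / C)" using eq by simp
  then have "(\<integral>x. g x \<partial>lborel) = 1 / C"
    using C gn by (subst integral_eq_nn_integral) auto
  then have "Z_norm t \<theta> l = 1 / C"
    by (simp add: Z_norm_def set_lebesgue_integral_def g_def)
  then show ?thesis by (simp add: rho_def mult.commute)
qed

lemma rho_1_eq:
  assumes t: "t > 0" and th: "\<theta> > 0"
  shows "rho t \<theta> 1 = dilate (t\<^sup>2 / \<theta>) (meas_inv (gamma_dist (1 + t / \<theta>) 1))"
proof -
  \<comment> \<open>Both constants are read off from the potential: \<open>\<kappa>\<close>
    multiplies \<open>1 / x\<close>, and the coefficient of \<open>ln x\<close> is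
    \<open>b + 1\<close>, as for an inverse gamma law.\<close>
  define \<kappa> where "\<kappa> = t\<^sup>2 / \<theta>"
  define b where "b = 1 + t / \<theta>"
  have \<kappa>: "\<kappa> > 0" and b: "b > 0" using t th by (auto simp: \<kappa>_def b_def add_pos_pos)
  have G: "Gamma b > 0" using b by simp
  define C where "C = \<kappa> powr b / Gamma b"
  have C: "C > 0" using \<kappa> G by (simp add: C_def)
  have "dilate \<kappa> (meas_inv (gamma_dist b 1)) =
      density lborel (\<lambda>x. ennreal (indicator {0<..} (x / \<kappa>) * (x / \<kappa>) powr (- b - 1) * exp (- 1 / (x / \<kappa>)) / Gamma b) * ennreal (1 / \<kappa>))"
    unfolding meas_inv_gamma_dist[OF b] by (rule dilate_density[OF \<kappa>]) measurable
  also have "\<dots> = density lborel (\<lambda>x. ennreal (C * (indicator {0<..} x * exp (- V_pot t \<theta> 1 x))))"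
  proof (intro arg_cong[where f = "density lborel"] ext)
    fix x :: real
    show "ennreal (indicator {0<..} (x / \<kappa>) * (x / \<kappa>) powr (- b - 1) * exp (- 1 / (x / \<kappa>)) / Gamma b) * ennreal (1 / \<kappa>) =
      ennreal (C * (indicator {0<..} x * exp (- V_pot t \<theta> 1 x)))"
    proof (cases "x > 0")
      case True
      have V: "V_pot t \<theta> 1 x = (b + 1) * ln x + \<kappa> / x"
        by (simp add: V_pot_def b_def \<kappa>_def field_simps)
      have e: "exp (- V_pot t \<theta> 1 x) = x powr (- b - 1) * exp (- \<kappa> / x)"
        unfolding V powr_def using True by (simp add: algebra_simps flip: exp_add)
      have k: "\<kappa> powr (- b - 1) = 1 / (\<kappa> * \<kappa> powr b)"
        using \<kappa> by (simp add: powr_diff powr_minus field_simps)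
      show ?thesis
        unfolding e using True \<kappa> G
        by (simp add: C_def powr_divide k field_simps flip: ennreal_mult)
    qed (use \<kappa> in \<open>simp add: zero_less_divide_iff\<close>)
  qed
  finally have eq: "dilate \<kappa> (meas_inv (gamma_dist b 1)) = \<dots>" .
  have "prob_space (dilate \<kappa> (meas_inv (gamma_dist b 1)))"
    unfolding dilate_def
    by (intro prob_space.prob_space_distr prob_space_meas_inv prob_space_gamma_dist b)
       (auto simp: meas_inv_def)
  then show ?thesis
    using rho_eq_density[OF C, of t \<theta> 1] unfolding eq \<kappa>_def[symmetric] b_def[symmetric] by simp
qed

lemma rho_eq_dilate_beta_prime:
  assumes t: "t > 0" and th: "\<theta> > 0" and l: "l > 1"
  shows "rho t \<theta> l = dilate (t * (l - 1)) (beta_prime (t / (\<theta> * (l - 1))) (1 + t / \<theta>))"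
proof -
  define s where "s = t * (l - 1)"
  define a where "a = t / (\<theta> * (l - 1))"
  define b where "b = 1 + t / \<theta>"
  have s: "s > 0" and a: "a > 0" and b: "b > 0"
    using t th l by (auto simp: s_def a_def b_def add_pos_pos)
  define B where "B = Beta a b"
  have B: "B > 0" unfolding B_def by (rule Beta_real_pos[OF a b])
  define C where "C = s powr b / B"
  have C: "C > 0" using s B by (simp add: C_def)
  have "dilate s (beta_prime a b) =
      density lborel (\<lambda>x. ennreal (beta_prime_weight a b (x / s) / B) * ennreal (1 / s))"
    unfolding beta_prime_def B_def by (rule dilate_density[OF s]) measurable
  also have "\<dots> = density lborel (\<lambda>x. ennreal (C * (indicator {0<..} x * exp (- V_pot t \<theta> l x))))"
  proof (intro arg_cong[where f = "density lborel"] ext)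
    fix x :: real
    show "ennreal (beta_prime_weight a b (x / s) / B) * ennreal (1 / s) =
      ennreal (C * (indicator {0<..} x * exp (- V_pot t \<theta> l x)))"
    proof (cases "x > 0")
      case True
      \<comment> \<open>Matching the coefficient of \<open>ln (x + s)\<close> forces
        \<open>b = 1 + t / \<theta>\<close>, which does not depend on \<open>l\<close>.\<close>
      have ab: "a + b = 1 + t * l / (\<theta> * (l - 1))"
        using th l by (simp add: a_def b_def field_simps)
      have V: "V_pot t \<theta> l x = (1 - a) * ln x + (a + b) * ln (x + s)"
        unfolding ab using l by (simp add: V_pot_def a_def s_def)
      have e: "exp (- V_pot t \<theta> l x) = x powr (a - 1) * (x + s) powr (- (a + b))"
        unfolding V powr_def using True s by (simp add: algebra_simps flip: exp_add)
      have "1 + x / s = (x + s) / s" using s by (simp add: field_simps)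
      then have w: "beta_prime_weight a b (x / s) = (x / s) powr (a - 1) * ((x + s) / s) powr (- (a + b))"
        using True s by (simp add: beta_prime_weight_def)
      have "(x / s) powr (a - 1) * ((x + s) / s) powr (- (a + b)) / s
          = x powr (a - 1) * (x + s) powr (- (a + b)) * (1 / (s powr (a - 1) * s powr (- (a + b)) * s))"
        using True s by (simp add: powr_divide)
      also have "s powr (a - 1) * s powr (- (a + b)) * s = s powr (- b)"
        using s by (simp add: powr_diff powr_minus powr_add field_simps)
      finally have "beta_prime_weight a b (x / s) / B * (1 / s) = C * exp (- V_pot t \<theta> l x)"
        unfolding w e using B s by (simp add: C_def powr_minus field_simps)
      then show ?thesis
        using True s B beta_prime_weight_nonneg[of a b "x / s"] by (simp flip: ennreal_mult)
    qed (use s in \<open>simp add: beta_prime_weight_def zero_less_divide_iff\<close>)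
  qed
  finally have eq: "dilate s (beta_prime a b) = \<dots>" .
  have "prob_space (dilate s (beta_prime a b))"
    unfolding dilate_def
    by (intro prob_space.prob_space_distr prob_space_beta_prime a b) (simp add: beta_prime_def)
  then show ?thesis
    using rho_eq_density[OF C, of t \<theta> l] unfolding eq s_def[symmetric] a_def[symmetric] b_def[symmetric] by simp
qed

text \<open>The inverse gamma factor has the same parameter in \<open>rho t \<theta> 1\<close> and
  in \<open>rho t \<theta> l\<close>. So it only remains to multiply the dilations,
  \<open>t\<^sup>2 / \<theta>\<close> from the first factor and the scale from the second.\<close>

lemma rho_eq_mult_conv:
  assumes t: "t > 0" and th: "\<theta> > 0" and l: "l > 1"
  shows "rho t \<theta> l = mult_conv (rho t \<theta> 1) (gamma_dist (t / (\<theta> * (l - 1))) (\<theta> * (l - 1) / t))"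
proof -
  define a where "a = t / (\<theta> * (l - 1))"
  define b where "b = 1 + t / \<theta>"
  have a: "a > 0" and b: "b > 0"
    using t th l by (auto simp: a_def b_def add_pos_pos)
  have I: "prob_space (meas_inv (gamma_dist b 1))"
    by (intro prob_space_meas_inv prob_space_gamma_dist b) simp
  have "sets (meas_inv (gamma_dist b 1)) = sets borel" by (simp add: meas_inv_def)
  note I = I this
  have c: "\<theta> * (l - 1) / t > 0" using t th l by simp
  have "mult_conv (rho t \<theta> 1) (gamma_dist a (\<theta> * (l - 1) / t))
    = dilate (t\<^sup>2 / \<theta> * (\<theta> * (l - 1) / t)) (mult_conv (meas_inv (gamma_dist b 1)) (gamma_dist a 1))"
    unfolding rho_1_eq[OF t th] gamma_dist_dilate[OF a c] b_def[symmetric]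
    using I a by (intro mult_conv_dilate prob_space_gamma_dist) auto
  also have "mult_conv (meas_inv (gamma_dist b 1)) (gamma_dist a 1) = mult_conv (gamma_dist a 1) (meas_inv (gamma_dist b 1))"
    using I a by (intro mult_conv_commute prob_space_gamma_dist) auto
  also have "t\<^sup>2 / \<theta> * (\<theta> * (l - 1) / t) = t * (l - 1)"
    using t th by (simp add: power2_eq_square)
  finally show ?thesis
    unfolding gamma_ratio_beta_prime[OF a b] rho_eq_dilate_beta_prime[OF assms] a_def[symmetric] b_def[symmetric] ..
qed

theorem theorem5p2:
  fixes t \<theta> l :: real
  assumes "t > 0" and "\<theta> > 0" and "l > 1"
  shows "rho t \<theta> l =
           dilate (t * (l - 1))
             (mult_conv (gamma_dist (t / (\<theta> * (l - 1))) 1)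
                        (meas_inv (gamma_dist (1 + t / \<theta>) 1)))
       \<and> rho t \<theta> l =
           mult_conv (rho t \<theta> 1)
             (gamma_dist (t / (\<theta> * (l - 1))) (\<theta> * (l - 1) / t))
       \<and> selfdecomposable (rho t \<theta> l)
       \<and> rho t \<theta> (1 + t / \<theta>) = mult_conv (rho t \<theta> 1) (gamma_dist 1 1)"
proof (intro conjI)
  define a where "a = t / (\<theta> * (l - 1))"
  define b where "b = 1 + t / \<theta>"
  have a: "a > 0" and b: "b \<ge> 1" "b > 0"
    using assms by (auto simp: a_def b_def add_pos_pos)
  note pr = prob_space_beta_prime[OF a b(2)]
  have eq: "rho t \<theta> l = dilate (t * (l - 1)) (beta_prime a b)"
    unfolding a_def b_def by (rule rho_eq_dilate_beta_prime[OF assms])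
  show "rho t \<theta> l = dilate (t * (l - 1))
      (mult_conv (gamma_dist (t / (\<theta> * (l - 1))) 1) (meas_inv (gamma_dist (1 + t / \<theta>) 1)))"
    unfolding eq gamma_ratio_beta_prime[OF a b(2), symmetric] by (simp add: a_def b_def)
  show "rho t \<theta> l = mult_conv (rho t \<theta> 1) (gamma_dist (t / (\<theta> * (l - 1))) (\<theta> * (l - 1) / t))"
    by (rule rho_eq_mult_conv[OF assms])
  show "selfdecomposable (rho t \<theta> l)"
    unfolding eq using selfdecomposable_beta_prime[OF a b(1) pr]
    by (intro selfdecomposable_dilate pr) (simp_all add: beta_prime_def)
  \<comment> \<open>For \<open>l = 1 + t / \<theta>\<close> shape and scale of the gamma factor are
    both 1, and \<open>gamma_dist 1 1\<close> is the standard exponential law; this is the asserted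
    mixture of exponentials.\<close>
  show "rho t \<theta> (1 + t / \<theta>) = mult_conv (rho t \<theta> 1) (gamma_dist 1 1)"
    using rho_eq_mult_conv[of t \<theta> "1 + t / \<theta>"] assms by simp
qed

end
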